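(* Let $\kappa$ be an infinite regular cardinal and let $\hat{\varphi}\colon [\kappa^+]^{<\omega}\to[\kappa]^{<\omega}$ be a $\kappa$-shrinking function. Then there exists a Simon point in $\beta\kappa\setminus\kappa$.
   Context: $\beta\kappa$ is the space of ultrafilters on $\kappa$ (the Čech–Stone compactification of the discrete space $\kappa$), and $\beta\kappa\setminus\kappa$ is the set of non-principal ultrafilters on $\kappa$; closures $\overline{X}$ are taken in $\beta\kappa$. A function $\hat{\varphi}\colon[\kappa^+]^{<\omega}\to[\kappa]^{<\omega}$ is $\kappa$-shrinking iff $p\subseteq q$ implies $\hat{\varphi}(p)\subseteq\hat{\varphi}(q)$ for all $p,q\in[\kappa^+]^{<\omega}$, and $\hat{\varphi}(\emptyset)=\emptyset$. A set $\{\mathcal{F}_\alpha\colon\alpha<\kappa\}$ of filters on $\kappa$ is $\kappa$-discrete iff there is a partition $\{A_\alpha\colon\alpha<\kappa\}$ of $\kappa$ with $A_\alpha\in\mathcal{F}_\alpha$ for each $\alpha<\kappa$. For a $\kappa$-discrete set $X=\{\mathcal{F}_\alpha\colon\alpha<\kappa\}\subseteq\beta\kappa$ and $\mathcal{F}\in\beta\kappa$, put $\Sigma(X,\mathcal{F})=\{A\subseteq\kappa\colon \{\alpha<\kappa\colon A\in\mathcal{F}_\alpha\}\in\mathcal{F}\}$. An ultrafilter $\mathcal{G}\in\beta\kappa\setminus\kappa$ is non-minimal (in the Rudin–Frolík order) iff there is a $\kappa$-discrete set $X\subseteq\beta\kappa\setminus\kappa$ with $\mathcal{G}\in\overline{X}\setminus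 X$; it is minimal otherwise. $\mathcal{G}$ has an immediate predecessor $\mathcal{F}$ iff $\mathcal{G}=\Sigma(X,\mathcal{F})$ for some $\kappa$-discrete set $X$ of minimal ultrafilters. A Simon point is an ultrafilter $\mathcal{G}\in\beta\kappa\setminus\kappa$ which is non-minimal and has no immediate predecessor. *)

theory Defs
  imports "HOL-Analysis.Analysis"
begin

(* Filters on a set K are families of subsets of K, so that K may be the field of an arbitrary
   cardinal order; the library type of filters always lives on a whole type and contains the
   improper filter. *)

definition filter_on :: "'a set \<Rightarrow> 'a set set \<Rightarrow> bool" where
  "filter_on K F \<longleftrightarrow>
     F \<subseteq> Pow K \<and> K \<in> F \<and> {} \<notin> F \<and>
     (\<forall>A\<in>F. \<forall>B\<in>F. A \<inter> B \<in> F) \<and>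
     (\<forall>A\<in>F. \<forall>B. A \<subseteq> B \<and> B \<subseteq> K \<longrightarrow> B \<in> F)"

definition beta :: "'a set \<Rightarrow> 'a set set set" where
  "beta K = {U. filter_on K U \<and> (\<forall>A. A \<subseteq> K \<longrightarrow> A \<in> U \<or> K - A \<in> U)}"

definition principal_at :: "'a set \<Rightarrow> 'a \<Rightarrow> 'a set set" where
  "principal_at K a = {A. A \<subseteq> K \<and> a \<in> A}"

definition beta_remainder :: "'a set \<Rightarrow> 'a set set set" where
  "beta_remainder K = beta K - principal_at K ` K"

definition beta_topology :: "'a set \<Rightarrow> 'a set set topology" where
  "beta_topology K = topology_generated_by {{U \<in> beta K. A \<in> U} |A. A \<subseteq> K}"

(* Discreteness of {X a : a in K} together with its enumeration X, which is needed to form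
   Rudin_sum. The pieces A a are nonempty, and X is injective on K, because no filter contains
   the empty set. *)

definition discrete_enum :: "'a set \<Rightarrow> ('a \<Rightarrow> 'a set set) \<Rightarrow> bool" where
  "discrete_enum K X \<longleftrightarrow>
     (\<forall>a\<in>K. filter_on K (X a)) \<and>
     (\<exists>A. disjoint_family_on A K \<and> (\<Union>a\<in>K. A a) = K \<and> (\<forall>a\<in>K. A a \<in> X a))"

definition discrete_filters :: "'a set \<Rightarrow> 'a set set set \<Rightarrow> bool" where
  "discrete_filters K S \<longleftrightarrow> (\<exists>X. discrete_enum K X \<and> S = X ` K)"

definition Rudin_sum :: "'a set \<Rightarrow> ('a \<Rightarrow> 'a set set) \<Rightarrow> 'a set set \<Rightarrow> 'a set set" where
  "Rudin_sum K X F = {A. A \<subseteq> K \<and> {a \<in> K. A \<in> X a} \<in> F}"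

definition non_minimal :: "'a set \<Rightarrow> 'a set set \<Rightarrow> bool" where
  "non_minimal K G \<longleftrightarrow>
     G \<in> beta_remainder K \<and>
     (\<exists>S. discrete_filters K S \<and> S \<subseteq> beta_remainder K \<and> G \<in> beta_topology K closure_of S - S)"

definition minimal :: "'a set \<Rightarrow> 'a set set \<Rightarrow> bool" where
  "minimal K G \<longleftrightarrow> G \<in> beta_remainder K \<and> \<not> non_minimal K G"

definition immediate_predecessor :: "'a set \<Rightarrow> 'a set set \<Rightarrow> 'a set set \<Rightarrow> bool" where
  "immediate_predecessor K F G \<longleftrightarrow>
     F \<in> beta K \<and>
     (\<exists>X. discrete_enum K X \<and> (\<forall>a\<in>K. minimal K (X a)) \<and> G = Rudin_sum K X F)"

definition Simon_point :: "'a set \<Rightarrow> 'a set set \<Rightarrow> bool" where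
  "Simon_point K G \<longleftrightarrow>
     G \<in> beta_remainder K \<and> non_minimal K G \<and> (\<nexists>F. immediate_predecessor K F G)"

(* For a cardinal order r, the cardinal is represented by Field r, its successor by
   Field (cardSuc r), and the finite subsets of a set B by Fpow B. *)

definition shrinking :: "'a rel \<Rightarrow> ('a set set \<Rightarrow> 'a set) \<Rightarrow> bool" where
  "shrinking r \<phi> \<longleftrightarrow>
     \<phi> \<in> Fpow (Field (cardSuc r)) \<rightarrow> Fpow (Field r) \<and>
     (\<forall>p\<in>Fpow (Field (cardSuc r)). \<forall>q\<in>Fpow (Field (cardSuc r)). p \<subseteq> q \<longrightarrow> \<phi> p \<subseteq> \<phi> q) \<and>
     \<phi> {} = {}"

end

theory Submission
  imports Defs
begin

text \<open>
  Everything happens on a countable subset of \<open>\<kappa>\<close>. Fix a free ultrafilter \<open>U\<close> on the natural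
  numbers and a map \<open>\<tau>\<close> to the tree of finite sequences of naturals. We look for ultrafilters
  \<open>x s\<close>, indexed by the nodes \<open>s\<close>, such that \<open>x s\<close> lives on the points whose \<open>\<tau>\<close>-value extends
  \<open>s\<close> and is the \<open>U\<close>-limit of the \<open>x (s @ [n])\<close>. Then every \<open>x s\<close> is non-minimal, in particular
  \<open>G = x []\<close> is. For \<open>G\<close> to have no immediate predecessor, every \<open>\<pi> : \<nat> \<rightarrow> \<nat>\<close> is settled: either
  \<open>\<pi>\<close> is constant modulo \<open>x s\<close> for all \<open>s\<close> on a bar of the tree, or \<open>G\<close> contains sets
  \<open>W a\<close>, one for each \<open>a \<subseteq> \<nat>\<close>, such that any \<open>n + 1\<close> of them have finite intersection inside
  \<open>\<pi> = n\<close>. Suppose \<open>G = \<Sigma>(X, F)\<close> with minimal \<open>X\<^sub>n\<close> living on \<open>\<pi> = n\<close>. In the second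
  case uncountably many \<open>W a\<close> belong to the same \<open>X\<^sub>n\<close>, which is then principal. In the first case
  \<open>G\<close> is in the closure of the non-minimal \<open>x s\<close> on the bar, so some minimal \<open>X\<^sub>n\<close> is in the closure of
  those on which \<open>\<pi> = n\<close>; they form a discrete set, and this makes \<open>X\<^sub>n\<close> non-minimal.

  The partitions are settled one after another, along a well-order of length continuum, in Kunen's
  style: the filters built so far stay independent of all but fewer than continuum many rows of an
  independent linked family, and each new \<open>\<pi>\<close> uses up countably many further rows. Finally the
  system of filters is extended to ultrafilters by Zorn's lemma.
\<close>

section \<open>Coherent systems of filters\<close>

definition fil :: "'b set set \<Rightarrow> bool" where
  "fil F \<longleftrightarrow> UNIV \<in> F \<and> {} \<notin> F \<and> (\<forall>A\<in>F. \<forall>B\<in>F. A \<inter> B \<in> F) \<and> (\<forall>A\<in>F. \<forall>B. A \<subseteq> B \<longrightarrow> B \<in> F)"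

definition ultra :: "'b set set \<Rightarrow> bool" where
  "ultra F \<longleftrightarrow> fil F \<and> (\<forall>A. A \<in> F \<or> - A \<in> F)"

lemma filD:
  assumes "fil F"
  shows fil_UNIV: "UNIV \<in> F" and fil_empty: "{} \<notin> F"
    and fil_Int: "A \<in> F \<Longrightarrow> B \<in> F \<Longrightarrow> A \<inter> B \<in> F"
    and fil_mono: "A \<in> F \<Longrightarrow> A \<subseteq> B \<Longrightarrow> B \<in> F"
  using assms unfolding fil_def by blast+

lemma ultra_fil: "ultra F \<Longrightarrow> fil F"
  by (simp add: ultra_def)

lemma ultra_Compl_iff: "ultra F \<Longrightarrow> - A \<in> F \<longleftrightarrow> A \<notin> F"
  by (metis Compl_disjoint fil_Int fil_empty ultra_def)

lemma ultra_Un: "ultra F \<Longrightarrow> A \<union> B \<in> F \<Longrightarrow> A \<in> F \<or> B \<in> F"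
  by (metis Compl_Un fil_Int ultra_Compl_iff ultra_fil)

lemma ultra_finite_UN:
  assumes "ultra F" "finite I" "(\<Union>i\<in>I. A i) \<in> F"
  shows "\<exists>i\<in>I. A i \<in> F"
  using assms(2,3)
proof (induction I)
  case empty
  then show ?case using assms(1) fil_empty ultra_fil by auto
next
  case (insert i I)
  then show ?case using ultra_Un[OF assms(1), of "A i" "\<Union>i\<in>I. A i"] by auto
qed

lemma ultra_finite:
  assumes "ultra F" "\<And>n. {n} \<notin> F" "finite A"
  shows "A \<notin> F"
  using ultra_finite_UN[OF assms(1,3), of "\<lambda>n. {n}"] assms(2) by auto

lemma ultra_ex: "ultra F \<Longrightarrow> {n. P n} \<in> F \<Longrightarrow> \<exists>n. P n"
  by (metis empty_Collect_eq fil_empty ultra_fil)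

section \<open>Coherent systems and bars of the tree\<close>

text \<open>One inclusion into the \<open>U\<close>-limit is enough: once the \<open>f s\<close> are
  ultrafilters and \<open>U\<close> is a filter, it is an equality, since ultrafilters are
  maximal.\<close>

definition coherent :: "nat set set \<Rightarrow> (nat list \<Rightarrow> 'b set set) \<Rightarrow> bool" where
  "coherent U f \<longleftrightarrow> (\<forall>s. fil (f s)) \<and> (\<forall>s A. A \<in> f s \<longrightarrow> {n. A \<in> f (s @ [n])} \<in> U)"

lemma coherent_fil: "coherent U f \<Longrightarrow> fil (f s)"
  by (simp add: coherent_def)

lemma coherentD: "coherent U f \<Longrightarrow> A \<in> f s \<Longrightarrow> {n. A \<in> f (s @ [n])} \<in> U"
  by (simp add: coherent_def)

text \<open>A bar in a well-founded tree rooted at \<open>s\<close> that branches into sets of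
  \<open>U\<close>; rule induction takes the place of ranks.\<close>

inductive barred :: "nat set set \<Rightarrow> (nat list \<Rightarrow> bool) \<Rightarrow> nat list \<Rightarrow> bool" for U P where
  base: "P s \<Longrightarrow> barred U P s"
| step: "B \<in> U \<Longrightarrow> (\<And>n. n \<in> B \<Longrightarrow> barred U P (s @ [n])) \<Longrightarrow> barred U P s"

lemma barred_mono:
  assumes "barred U P s" "\<And>s. P s \<Longrightarrow> P' s"
  shows "barred U P' s"
  using assms(1) by induction (auto intro: barred.intros assms(2))

text \<open>Dual to \<open>barred_children\<close>. Each of the two supplies the closure condition
  under which \<open>coherent_adjoin\<close> may enlarge the filters at the unbarred, respectively
  barred, nodes only.\<close>

lemma not_barred:
  assumes "ultra U" "\<not> barred U P s"
  shows "{n. \<not> barred U P (s @ [n])} \<in> U"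
proof (rule ccontr)
  assume "\<not> ?thesis"
  then have "- {n. \<not> barred U P (s @ [n])} \<in> U" using ultra_Compl_iff[OF assms(1)] by blast
  then show False using assms(2) barred.step by blast
qed

lemma barred_children:
  assumes "fil U" "\<And>s. P s \<Longrightarrow> {n. P (s @ [n])} \<in> U" "barred U P s"
  shows "{n. barred U P (s @ [n])} \<in> U"
  using assms(3)
proof cases
  case base
  show ?thesis by (rule fil_mono[OF assms(1) assms(2)[OF base]]) (auto intro: barred.base)
next
  case (step B)
  show ?thesis by (rule fil_mono[OF assms(1) step(1)]) (use step(2) in auto)
qed

text \<open>Stopping each branch at its first \<open>P\<close>-node turns the bar into an
  antichain.\<close>

lemma barred_first:
  assumes "barred U P s" "\<And>k. k < length s \<Longrightarrow> \<not> P (take k s)"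
  shows "barred U (\<lambda>s. P s \<and> (\<forall>k<length s. \<not> P (take k s))) s"
  using assms
proof induction
  case (base s)
  then show ?case by (auto intro: barred.base)
next
  case (step B s)
  show ?case
  proof (cases "P s")
    case True
    then show ?thesis using step.prems by (auto intro: barred.base)
  next
    case False
    have "\<not> P (take k (s @ [n]))" if "k < length (s @ [n])" for k n
      using that False step.prems[of k] by (cases "k = length s") auto
    then show ?thesis using step.IH step.hyps by (auto intro: barred.step)
  qed
qed

text \<open>Coherence carries \<open>V\<close> to \<open>U\<close>-many children and
  \<open>U\<close>-many children are barred, so \<open>V\<close> can be followed down to the bar.
  For ultrafilters this puts \<open>x s\<close> into the closure of the \<open>x t\<close> on the
  bar.\<close>

lemma barred_hit:
  assumes "fil U" "coherent U x" "barred U P s" "V \<in> x s"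
  shows "\<exists>t. P t \<and> V \<in> x t"
  using assms(3,4)
proof induction
  case (base s)
  then show ?case by blast
next
  case (step B s)
  have "B \<inter> {n. V \<in> x (s @ [n])} \<in> U"
    using step coherentD[OF assms(2)] fil_Int[OF assms(1)] by blast
  then obtain n where "n \<in> B" "V \<in> x (s @ [n])" using fil_empty[OF assms(1)] by (metis (lifting) Int_iff equals0I mem_Collect_eq)
  then show ?case using step by blast
qed

section \<open>Extending coherent systems\<close>

definition adjoin :: "(nat list \<Rightarrow> 'b set set) \<Rightarrow> nat list set \<Rightarrow> 'b set set \<Rightarrow> nat list \<Rightarrow> 'b set set" where
  "adjoin f P \<W> s = (if s \<in> P then {B. \<exists>V\<in>f s. \<exists>C\<in>\<W>. V \<inter> C \<subseteq> B} else f s)"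

lemma adjoin_ge: "\<W> \<noteq> {} \<Longrightarrow> f s \<subseteq> adjoin f P \<W> s"
  by (auto simp: adjoin_def)

lemma adjoin_mem: "fil (f s) \<Longrightarrow> s \<in> P \<Longrightarrow> C \<in> \<W> \<Longrightarrow> C \<in> adjoin f P \<W> s"
  using fil_UNIV by (auto simp: adjoin_def)

text \<open>The new generators are the same at all nodes of \<open>P\<close>, so a set above
  \<open>V \<inter> C\<close> at \<open>s\<close> is inherited by the \<open>U\<close>-many children
  that lie in \<open>P\<close> and whose filter contains \<open>V\<close>.\<close>

lemma coherent_adjoin:
  assumes U: "fil U" and f: "coherent U f"
    and P: "\<And>s. s \<in> P \<Longrightarrow> {n. s @ [n] \<in> P} \<in> U"
    and W: "\<W> \<noteq> {}" "\<And>C C'. C \<in> \<W> \<Longrightarrow> C' \<in> \<W> \<Longrightarrow> C \<inter> C' \<in> \<W>"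
    and compat: "\<And>s V C. s \<in> P \<Longrightarrow> V \<in> f s \<Longrightarrow> C \<in> \<W> \<Longrightarrow> V \<inter> C \<noteq> {}"
  shows "coherent U (adjoin f P \<W>)"
  unfolding coherent_def
proof (intro conjI allI impI)
  fix s
  note fs = coherent_fil[OF f, of s]
  show "fil (adjoin f P \<W> s)"
  proof (cases "s \<in> P")
    case True
    have "A \<inter> B \<in> adjoin f P \<W> s" if AB: "A \<in> adjoin f P \<W> s" "B \<in> adjoin f P \<W> s" for A B
    proof -
      obtain V C V' C' where "V \<in> f s" "C \<in> \<W>" "V \<inter> C \<subseteq> A" "V' \<in> f s" "C' \<in> \<W>" "V' \<inter> C' \<subseteq> B"
        using AB True by (auto simp: adjoin_def)
      then have "V \<inter> V' \<in> f s" "C \<inter> C' \<in> \<W>" "(V \<inter> V') \<inter> (C \<inter> C') \<subseteq> A \<inter> B"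
        using W(2) fil_Int[OF fs] by auto
      then show ?thesis using True by (auto simp: adjoin_def)
    qed
    moreover have "UNIV \<in> adjoin f P \<W> s" using W(1) fil_UNIV[OF fs] by (auto simp: adjoin_def)
    moreover have "{} \<notin> adjoin f P \<W> s" using True compat by (auto simp: adjoin_def)
    moreover have "B \<in> adjoin f P \<W> s" if "A \<in> adjoin f P \<W> s" "A \<subseteq> B" for A B
      using that True unfolding adjoin_def by (simp; meson order_trans)
    ultimately show ?thesis unfolding fil_def by blast
  qed (simp add: adjoin_def fs)
next
  fix s A assume A: "A \<in> adjoin f P \<W> s"
  show "{n. A \<in> adjoin f P \<W> (s @ [n])} \<in> U"
  proof (cases "s \<in> P")
    case True
    then obtain V C where VC: "V \<in> f s" "C \<in> \<W>" "V \<inter> C \<subseteq> A" using A by (auto simp: adjoin_def)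
    have "{n. V \<in> f (s @ [n])} \<inter> {n. s @ [n] \<in> P} \<in> U"
      using fil_Int[OF U] coherentD[OF f VC(1)] P[OF True] by blast
    then show ?thesis by (rule fil_mono[OF U]) (use VC in \<open>auto simp: adjoin_def\<close>)
  next
    case False
    then have "A \<in> f s" using A by (simp add: adjoin_def)
    from coherentD[OF f this] show ?thesis
      by (rule fil_mono[OF U]) (use adjoin_ge[OF W(1)] in blast)
  qed
qed

lemma coherent_UN:
  assumes U: "fil U" and ne: "\<F> \<noteq> {}" and coh: "\<And>f. f \<in> \<F> \<Longrightarrow> coherent U f"
    and chain: "\<And>f g. f \<in> \<F> \<Longrightarrow> g \<in> \<F> \<Longrightarrow> f \<le> g \<or> g \<le> f"
  shows "coherent U (\<lambda>s. \<Union>f\<in>\<F>. f s)"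
  unfolding coherent_def
proof (intro conjI allI impI)
  fix s
  have fs: "fil (g s)" if "g \<in> \<F>" for g using coherent_fil[OF coh[OF that]] .
  have "A \<inter> B \<in> (\<Union>f\<in>\<F>. f s)" if AB: "A \<in> (\<Union>f\<in>\<F>. f s)" "B \<in> (\<Union>f\<in>\<F>. f s)" for A B
  proof -
    obtain f g where fg: "f \<in> \<F>" "g \<in> \<F>" "A \<in> f s" "B \<in> g s" using AB by blast
    then have "f s \<subseteq> g s \<or> g s \<subseteq> f s" using chain by (meson le_funD)
    then show ?thesis using fg fil_Int[OF fs] by blast
  qed
  moreover have "UNIV \<in> (\<Union>f\<in>\<F>. f s)" using ne fil_UNIV[OF fs] by blast
  moreover have "{} \<notin> (\<Union>f\<in>\<F>. f s)" using fil_empty[OF fs] by blast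
  moreover have "B \<in> (\<Union>f\<in>\<F>. f s)" if A: "A \<in> (\<Union>f\<in>\<F>. f s)" "A \<subseteq> B" for A B
  proof -
    obtain f where "f \<in> \<F>" "A \<in> f s" using A by blast
    then have "f \<in> \<F>" "B \<in> f s" by (simp, rule fil_mono[OF fs _ A(2)])
    then show ?thesis by blast
  qed
  ultimately show "fil (\<Union>f\<in>\<F>. f s)"
    unfolding fil_def by (intro conjI ballI allI impI)
next
  fix s A assume "A \<in> (\<Union>f\<in>\<F>. f s)"
  then obtain f where f: "f \<in> \<F>" "A \<in> f s" by blast
  from coherentD[OF coh[OF f(1)] f(2)] show "{n. A \<in> (\<Union>f\<in>\<F>. f (s @ [n]))} \<in> U"
    by (rule fil_mono[OF U]) (use f in blast)
qed

lemma coherent_maximal: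
  fixes f :: "nat list \<Rightarrow> 'b set set"
  assumes U: "fil U" and f: "coherent U f"
  obtains x where "coherent U x" "f \<le> x" "\<And>g. coherent U g \<Longrightarrow> x \<le> g \<Longrightarrow> g = x"
proof -
  \<comment> \<open>Systems are coded as sets of pairs, so that the pointwise order becomes
    inclusion and Zorn's lemma for families of sets applies.\<close>
  define sys where "sys p = (\<lambda>s. p `` {s})" for p :: "(nat list \<times> 'b set) set"
  define gr where "gr g = {(s, A). A \<in> g s}" for g :: "nat list \<Rightarrow> 'b set set"
  have [simp]: "sys (gr g) = g" for g by (auto simp: sys_def gr_def)
  have mono: "p \<subseteq> q \<longleftrightarrow> sys p \<le> sys q" for p q by (auto simp: sys_def le_fun_def)
  define \<A> where "\<A> = {p. coherent U (sys p) \<and> f \<le> sys p}"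
  have "\<exists>M\<in>\<A>. \<forall>X\<in>\<A>. M \<subseteq> X \<longrightarrow> X = M"
  proof (rule subset_Zorn_nonempty)
    show "\<A> \<noteq> {}" using f by (auto simp: \<A>_def intro!: exI[of _ "gr f"])
    fix \<C> assume ne: "\<C> \<noteq> {}" and ch: "subset.chain \<A> \<C>"
    have eq: "sys (\<Union>\<C>) = (\<lambda>s. \<Union>g\<in>sys ` \<C>. g s)" by (auto simp: sys_def)
    have "coherent U (sys (\<Union>\<C>))"
      unfolding eq
    proof (rule coherent_UN[OF U])
      show "sys ` \<C> \<noteq> {}" using ne by simp
      show "coherent U g" if "g \<in> sys ` \<C>" for g
        using that ch by (auto simp: subset.chain_def \<A>_def)
      show "g \<le> h \<or> h \<le> g" if gh: "g \<in> sys ` \<C>" "h \<in> sys ` \<C>" for g h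
      proof -
        obtain p q where pq: "p \<in> \<C>" "q \<in> \<C>" "g = sys p" "h = sys q" using gh by blast
        then have "p \<subseteq> q \<or> q \<subseteq> p" using ch by (auto simp: subset_chain_def)
        then show ?thesis using pq mono by simp
      qed
    qed
    moreover obtain p where p: "p \<in> \<C>" using ne by blast
    then have "f \<le> sys p" using ch by (auto simp: subset.chain_def \<A>_def)
    then have "f \<le> sys (\<Union>\<C>)" using p mono[of p "\<Union>\<C>"] by (meson Union_upper order_trans)
    ultimately show "\<Union>\<C> \<in> \<A>" by (simp add: \<A>_def)
  qed
  then obtain M where M: "M \<in> \<A>" "\<And>X. X \<in> \<A> \<Longrightarrow> M \<subseteq> X \<Longrightarrow> X = M" by blast
  show thesis
  proof
    show "coherent U (sys M)" "f \<le> sys M" using M(1) by (auto simp: \<A>_def)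
    fix g assume g: "coherent U g" "sys M \<le> g"
    then have "gr g \<in> \<A>" "M \<subseteq> gr g"
      using M(1) mono[of M "gr g"] order_trans by (auto simp: \<A>_def)
    then have "gr g = M" by (rule M(2))
    then show "g = sys M" by auto
  qed
qed

text \<open>Take a maximal system \<open>x\<close>. Adjoining \<open>- A\<close> at the nodes barred
  by those with \<open>- A \<in> x s\<close>, or else \<open>A\<close> at all other nodes, keeps it
  coherent; by maximality the adjoined set was there already.\<close>

lemma coherent_ultra:
  assumes U: "ultra U" and f: "coherent U f"
  obtains x where "coherent U x" "f \<le> x" "\<And>s. ultra (x s)"
proof -
  note UF = ultra_fil[OF U]
  obtain x where x: "coherent U x" "f \<le> x" and max: "\<And>g. coherent U g \<Longrightarrow> x \<le> g \<Longrightarrow> g = x"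
    using coherent_maximal[OF UF f] by metis
  have "A \<in> x s \<or> - A \<in> x s" for A s
  proof -
    define neg where "neg = barred U (\<lambda>s. - A \<in> x s)"
    have neg_meets: "V \<inter> - A \<noteq> {}" if "neg t" "V \<in> x t" for t V
    proof -
      obtain u where "- A \<in> x u" "V \<in> x u"
        using barred_hit[OF UF x(1) \<open>neg t\<close>[unfolded neg_def] \<open>V \<in> x t\<close>] by blast
      then show ?thesis
        using fil_Int[OF coherent_fil[OF x(1)]] fil_empty[OF coherent_fil[OF x(1)]] by metis
    qed
    have pos_meets: "V \<inter> A \<noteq> {}" if "\<not> neg t" "V \<in> x t" for t V
    proof
      assume "V \<inter> A = {}"
      then have "- A \<in> x t" using fil_mono[OF coherent_fil[OF x(1)] that(2)] by blast
      then show False using \<open>\<not> neg t\<close> by (auto simp: neg_def intro: barred.base)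
    qed
    have "coherent U (adjoin x {s. neg s} {- A})"
      by (rule coherent_adjoin[OF UF x(1)])
        (use neg_meets barred_children[OF UF coherentD[OF x(1)]] in \<open>auto simp: neg_def\<close>)
    from max[OF this] have 1: "adjoin x {s. neg s} {- A} = x" by (simp add: le_fun_def adjoin_ge)
    have "coherent U (adjoin x {s. \<not> neg s} {A})"
      by (rule coherent_adjoin[OF UF x(1)])
        (use pos_meets not_barred[OF U] in \<open>auto simp: neg_def\<close>)
    from max[OF this] have 2: "adjoin x {s. \<not> neg s} {A} = x" by (simp add: le_fun_def adjoin_ge)
    show ?thesis
    proof (cases "neg s")
      case True
      then show ?thesis using adjoin_mem[where f = x, OF coherent_fil[OF x(1)], of s "{s. neg s}" "- A" "{- A}"] 1
        by simp
    next
      case False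
      then show ?thesis using adjoin_mem[where f = x, OF coherent_fil[OF x(1)], of s "{s. \<not> neg s}" A "{A}"] 2
        by simp
    qed
  qed
  then have "ultra (x s)" for s using coherent_fil[OF x(1)] by (simp add: ultra_def)
  then show thesis by (rule that[OF x])
qed

lemma free_ultrafilter_exists: "\<exists>U :: nat set set. ultra U \<and> (\<forall>n. {n} \<notin> U)"
proof -
  \<comment> \<open>Over a principal \<open>U\<close> coherence is vacuous for constant systems.\<close>
  let ?U = "{A. (0::nat) \<in> A}" and ?f = "\<lambda>s :: nat list. {A :: nat set. finite (- A)}"
  have "ultra ?U" by (auto simp: ultra_def fil_def)
  moreover have "coherent ?U ?f"
    by (auto simp: coherent_def fil_def intro: finite_subset[rotated])
  ultimately obtain x where x: "coherent ?U x" "?f \<le> x" "\<And>s. ultra (x s)"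
    by (rule coherent_ultra) blast
  have "- {n} \<in> x []" for n using le_funD[OF x(2), of "[]"] by auto
  then have "{n} \<notin> x []" for n using ultra_Compl_iff[OF x(3)] by blast
  then show ?thesis using x(3) by blast
qed

section \<open>An independent linked family\<close>

text \<open>Finitely many pairs differ at finitely many points, and any \<open>k\<close> beyond
  these will do. Thus finite traces can stand for subsets of \<open>nat\<close> in a countable
  coding.\<close>

lemma eventually_separated:
  fixes \<Lambda> :: "nat set set"
  assumes "finite \<Lambda>"
  shows "\<exists>k0. \<forall>k\<ge>k0. inj_on (\<lambda>a. a \<inter> {..<k}) \<Lambda>"
proof -
  have "\<exists>m. a \<noteq> b \<longrightarrow> (m \<in> a) \<noteq> (m \<in> b)" for a b :: "nat set" by blast
  then obtain m where m: "\<And>a b :: nat set. a \<noteq> b \<Longrightarrow> (m a b \<in> a) \<noteq> (m a b \<in> b)" by metis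
  define k0 where "k0 = Suc (Max (insert 0 ((\<lambda>(a, b). m a b) ` (\<Lambda> \<times> \<Lambda>))))"
  have "m a b < k0" if "a \<in> \<Lambda>" "b \<in> \<Lambda>" for a b
    unfolding k0_def less_Suc_eq_le using that assms by (intro Max_ge) auto
  then show ?thesis
    unfolding inj_on_def using m by (metis IntD1 IntI lessThan_iff less_le_trans)
qed

text \<open>An independent linked family in Kunen's style, with rows \<open>i\<close>, columns
  \<open>a\<close> and levels \<open>n\<close>, transferred to \<open>nat\<close> from a countable
  set of finite approximations. Each approximation also carries a node \<open>t\<close>, so
  independence holds on every fibre of \<open>\<tau>\<close>.\<close>

lemma linked_family_exists:
  "\<exists>(\<tau> :: nat \<Rightarrow> nat list) (A :: nat set \<Rightarrow> nat set \<Rightarrow> nat \<Rightarrow> nat set).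
     (\<forall>i a m n. m \<le> n \<longrightarrow> A i a m \<subseteq> A i a n) \<and>
     (\<forall>i n \<Lambda>. finite \<Lambda> \<longrightarrow> card \<Lambda> = Suc n \<longrightarrow> finite (\<Inter>a\<in>\<Lambda>. A i a n)) \<and>
     (\<forall>t Q \<Lambda> n. finite Q \<longrightarrow> (\<forall>i\<in>Q. finite (\<Lambda> i) \<and> card (\<Lambda> i) \<le> n i) \<longrightarrow>
        (\<exists>d. \<tau> d = t \<and> (\<forall>i\<in>Q. \<forall>a\<in>\<Lambda> i. d \<in> A i a (n i))))"
proof -
  \<comment> \<open>A point is a node \<open>t\<close>, a cut-off \<open>k\<close> and a relation
    \<open>h\<close> between traces on \<open>{..<k}\<close>. The bound
    \<open>to_nat t \<le> k\<close> leaves finitely many points below each cut-off, which gives both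
    countability and thinness.\<close>
  define D where "D = {(t :: nat list, k :: nat, h). to_nat t \<le> k \<and> h \<subseteq> Pow {..<k} \<times> Pow {..<k}}"
  have fin: "finite {(t, k, h). (t, k, h) \<in> D \<and> k < k0}" for k0
  proof (rule finite_subset)
    have "finite {t :: nat list. to_nat t \<le> k0}"
      by (rule finite_subset[OF _ finite_imageI[OF finite_atMost[of k0], of from_nat]])
        (auto intro!: rev_image_eqI)
    then show "finite ({t :: nat list. to_nat t \<le> k0} \<times> {..<k0} \<times> Pow (Pow {..<k0} \<times> Pow {..<k0}))"
      by auto
  qed (fastforce simp: D_def)
  have "D = (\<Union>k0. {(t, k, h). (t, k, h) \<in> D \<and> k < k0})" by auto
  moreover have "countable (\<Union>k0. {(t, k, h). (t, k, h) \<in> D \<and> k < k0})"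
    by (rule countable_UN[OF countableI_type countable_finite[OF fin]])
  ultimately have cD: "countable D" by simp
  have "infinite D"
  proof
    have "(\<lambda>k. ([], to_nat ([] :: nat list) + k, {})) ` UNIV \<subseteq> D" by (auto simp: D_def)
    moreover have "inj (\<lambda>k. ([] :: nat list, to_nat ([] :: nat list) + k, {} :: (nat set \<times> nat set) set))"
      by (auto simp: inj_on_def)
    moreover assume "finite D"
    ultimately show False by (meson finite_subset finite_imageD infinite_UNIV_nat)
  qed
  then have bij: "bij_betw (from_nat_into D) UNIV D" using cD by (rule bij_betw_from_nat_into[rotated])
  define \<delta> where "\<delta> = from_nat_into D"
  define \<tau> where "\<tau> d = fst (\<delta> d)" for d
  \<comment> \<open>The relation \<open>h\<close> must list the trace of \<open>a\<close> in the row
    of \<open>i\<close>, and at most \<open>n\<close> traces in that row. Once \<open>n + 1\<close>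
    columns have distinct traces they cannot all be listed, so lying in all their sets bounds
    \<open>k\<close>.\<close>
  define A where "A i a n = {d. case \<delta> d of (t, k, h) \<Rightarrow>
      (i \<inter> {..<k}, a \<inter> {..<k}) \<in> h \<and> card (h `` {i \<inter> {..<k}}) \<le> n}" for i a n
  have "A i a m \<subseteq> A i a n" if "m \<le> n" for i a m n using that by (auto simp: A_def)
  moreover have "finite (\<Inter>a\<in>\<Lambda>. A i a n)" if \<Lambda>: "finite \<Lambda>" "card \<Lambda> = Suc n" for i n \<Lambda>
  proof -
    obtain k0 where k0: "\<And>k. k \<ge> k0 \<Longrightarrow> inj_on (\<lambda>a. a \<inter> {..<k}) \<Lambda>"
      using eventually_separated[OF \<Lambda>(1)] by blast
    have "\<delta> d \<in> {(t, k, h). (t, k, h) \<in> D \<and> k < k0}" if d: "d \<in> (\<Inter>a\<in>\<Lambda>. A i a n)" for d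
    proof -
      obtain t k h where e: "\<delta> d = (t, k, h)" by (cases "\<delta> d")
      have inD: "(t, k, h) \<in> D" using bij e unfolding \<delta>_def bij_betw_def by (metis rangeI)
      have sub: "(\<lambda>a. a \<inter> {..<k}) ` \<Lambda> \<subseteq> h `` {i \<inter> {..<k}}" using d e by (auto simp: A_def)
      have "finite h" using inD finite_subset[of h "Pow {..<k} \<times> Pow {..<k}"] by (auto simp: D_def)
      then have "finite (h `` {i \<inter> {..<k}})" by auto
      from card_mono[OF this sub] have "card ((\<lambda>a. a \<inter> {..<k}) ` \<Lambda>) \<le> card (h `` {i \<inter> {..<k}})" .
      also obtain a where "a \<in> \<Lambda>" using \<Lambda>(2) by fastforce
      then have "d \<in> A i a n" using d by blast
      then have "card (h `` {i \<inter> {..<k}}) \<le> n" using e by (simp add: A_def)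
      finally have "card ((\<lambda>a. a \<inter> {..<k}) ` \<Lambda>) \<noteq> card \<Lambda>" using \<Lambda>(2) by simp
      then have "\<not> k \<ge> k0" using card_image[OF k0] by metis
      then show ?thesis using inD e by simp
    qed
    then have "\<delta> ` (\<Inter>a\<in>\<Lambda>. A i a n) \<subseteq> {(t, k, h). (t, k, h) \<in> D \<and> k < k0}"
      by (rule image_subsetI)
    then have "finite (\<delta> ` (\<Inter>a\<in>\<Lambda>. A i a n))" by (rule finite_subset[OF _ fin])
    moreover have "inj \<delta>" using bij by (simp add: \<delta>_def bij_betw_def)
    ultimately show ?thesis by (meson finite_imageD inj_on_subset subset_UNIV)
  qed
  moreover have "\<exists>d. \<tau> d = t \<and> (\<forall>i\<in>Q. \<forall>a\<in>\<Lambda> i. d \<in> A i a (n i))"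
    if Q: "finite Q" "\<forall>i\<in>Q. finite (\<Lambda> i) \<and> card (\<Lambda> i) \<le> n i" for t Q \<Lambda> n
  proof -
    obtain k0 where k0: "\<And>k. k \<ge> k0 \<Longrightarrow> inj_on (\<lambda>a. a \<inter> {..<k}) Q"
      using eventually_separated[OF Q(1)] by blast
    \<comment> \<open>A cut-off separating the rows in \<open>Q\<close> keeps their lists in
      \<open>h\<close> apart, so that none grows too long.\<close>
    define k where "k = max k0 (to_nat t)"
    define h where "h = {(i \<inter> {..<k}, a \<inter> {..<k}) |i a. i \<in> Q \<and> a \<in> \<Lambda> i}"
    have "(t, k, h) \<in> D" by (auto simp: D_def k_def h_def)
    then obtain d where d: "\<delta> d = (t, k, h)" using bij unfolding \<delta>_def bij_betw_def by (metis imageE)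
    have "card (h `` {i \<inter> {..<k}}) \<le> n i" if i: "i \<in> Q" for i
    proof -
      have inj: "inj_on (\<lambda>a. a \<inter> {..<k}) Q" using k0 by (simp add: k_def)
      have "h `` {i \<inter> {..<k}} \<subseteq> (\<lambda>a. a \<inter> {..<k}) ` \<Lambda> i"
      proof
        fix c assume "c \<in> h `` {i \<inter> {..<k}}"
        then obtain j a where "j \<in> Q" "i \<inter> {..<k} = j \<inter> {..<k}" "a \<in> \<Lambda> j" "c = a \<inter> {..<k}"
          by (auto simp: h_def)
        then show "c \<in> (\<lambda>a. a \<inter> {..<k}) ` \<Lambda> i" using inj_onD[OF inj, of i j] i by blast
      qed
      then show ?thesis using Q(2) i by (meson card_image_le card_mono finite_imageI le_trans)
    qed
    moreover have "(i \<inter> {..<k}, a \<inter> {..<k}) \<in> h" if "i \<in> Q" "a \<in> \<Lambda> i" for i a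
      using that by (auto simp: h_def)
    ultimately have "\<forall>i\<in>Q. \<forall>a\<in>\<Lambda> i. d \<in> A i a (n i)" using d by (simp add: A_def)
    moreover have "\<tau> d = t" using d by (simp add: \<tau>_def)
    ultimately show ?thesis by (intro exI[of _ d] conjI)
  qed
  ultimately show ?thesis by (intro exI[of _ \<tau>] exI[of _ A] conjI allI impI)
qed

section \<open>Settling all partitions\<close>

locale linked_tree =
  fixes U :: "nat set set" and \<tau> :: "nat \<Rightarrow> nat list" and A :: "nat set \<Rightarrow> nat set \<Rightarrow> nat \<Rightarrow> nat set"
  assumes U: "ultra U"
    and mono: "m \<le> n \<Longrightarrow> A i a m \<subseteq> A i a n"
    and thin: "finite \<Lambda> \<Longrightarrow> card \<Lambda> = Suc n \<Longrightarrow> finite (\<Inter>a\<in>\<Lambda>. A i a n)"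
    and indep: "finite Q \<Longrightarrow> \<forall>i\<in>Q. finite (\<Theta> i) \<and> card (\<Theta> i) \<le> k i \<Longrightarrow>
      \<exists>d. \<tau> d = t \<and> (\<forall>i\<in>Q. \<forall>a\<in>\<Theta> i. d \<in> A i a (k i))"
begin

lemmas UF = ultra_fil[OF U]

section \<open>Subtrees, cylinders and unspent rows\<close>

definition subtree :: "nat list \<Rightarrow> nat set" where
  "subtree s = {d. take (length s) (\<tau> d) = s}"

lemma subtree_append: "subtree (s @ t) \<subseteq> subtree s"
proof
  fix d assume "d \<in> subtree (s @ t)"
  then have "take (length s) (take (length (s @ t)) (\<tau> d)) = s" by (simp add: subtree_def)
  then show "d \<in> subtree s" by (simp add: subtree_def min_def)
qed

text \<open>For finite \<open>Q\<close> these are exactly the conditions that \<open>indep\<close>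
  can realise.\<close>

definition cylinder :: "nat set set \<Rightarrow> nat set set" where
  "cylinder Q = {E. \<exists>\<Lambda> n. (\<forall>i\<in>Q. finite (\<Lambda> i) \<and> card (\<Lambda> i) \<le> n i) \<and>
     E = {d. \<forall>i\<in>Q. \<forall>a\<in>\<Lambda> i. d \<in> A i a (n i)}}"

lemma cylinder_empty: "UNIV \<in> cylinder {}"
  by (auto simp: cylinder_def)

lemma cylinder_single: "finite \<Lambda> \<Longrightarrow> {d. \<forall>a\<in>\<Lambda>. d \<in> A i a (card \<Lambda>)} \<in> cylinder {i}"
  unfolding cylinder_def by (intro CollectI exI[of _ "\<lambda>_. \<Lambda>"] exI[of _ "\<lambda>_. card \<Lambda>"]) auto

text \<open>Conditions on disjoint sets of rows are pasted by cases. On a shared row the joint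
  number of columns could exceed the level.\<close>

lemma cylinder_Int:
  assumes "E \<in> cylinder Q" "E' \<in> cylinder Q'" "Q \<inter> Q' = {}"
  shows "E \<inter> E' \<in> cylinder (Q \<union> Q')"
proof -
  obtain \<Lambda> n where 1: "\<forall>i\<in>Q. finite (\<Lambda> i) \<and> card (\<Lambda> i) \<le> n i"
      "E = {d. \<forall>i\<in>Q. \<forall>a\<in>\<Lambda> i. d \<in> A i a (n i)}"
    using assms(1) by (auto simp: cylinder_def)
  obtain \<Lambda>' n' where 2: "\<forall>i\<in>Q'. finite (\<Lambda>' i) \<and> card (\<Lambda>' i) \<le> n' i"
      "E' = {d. \<forall>i\<in>Q'. \<forall>a\<in>\<Lambda>' i. d \<in> A i a (n' i)}"
    using assms(2) by (auto simp: cylinder_def)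
  let ?\<Lambda> = "\<lambda>i. if i \<in> Q then \<Lambda> i else \<Lambda>' i" and ?n = "\<lambda>i. if i \<in> Q then n i else n' i"
  have Q: "i \<notin> Q" if "i \<in> Q'" for i using assms(3) that by blast
  have "\<forall>i\<in>Q \<union> Q'. finite (?\<Lambda> i) \<and> card (?\<Lambda> i) \<le> ?n i"
    using 1(1) 2(1) Q by (simp add: ball_Un)
  moreover have "E \<inter> E' = {d. \<forall>i\<in>Q \<union> Q'. \<forall>a\<in>?\<Lambda> i. d \<in> A i a (?n i)}"
    unfolding 1(2) 2(2) using Q by (simp add: ball_Un set_eq_iff)
  ultimately show ?thesis
    unfolding cylinder_def by (intro CollectI exI[of _ ?\<Lambda>] exI[of _ ?n] conjI)
qed

lemma subtree_Int_cylinder: "finite Q \<Longrightarrow> E \<in> cylinder Q \<Longrightarrow> subtree s \<inter> E \<noteq> {}"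
proof -
  assume Q: "finite Q" and "E \<in> cylinder Q"
  then obtain \<Lambda> n where E: "\<forall>i\<in>Q. finite (\<Lambda> i) \<and> card (\<Lambda> i) \<le> n i"
      "E = {d. \<forall>i\<in>Q. \<forall>a\<in>\<Lambda> i. d \<in> A i a (n i)}"
    by (auto simp: cylinder_def)
  then obtain d where "\<tau> d = s" "d \<in> E" using indep[OF Q E(1), of s] by blast
  then have "d \<in> subtree s \<inter> E" by (simp add: subtree_def)
  then show ?thesis by blast
qed

definition system :: "(nat list \<Rightarrow> nat set set) \<Rightarrow> bool" where
  "system f \<longleftrightarrow> coherent U f \<and> (\<forall>s. subtree s \<in> f s)"

text \<open>\<open>J\<close> holds the rows already spent; those outside it are reserved for
  partitions still to be settled.\<close>

definition independent :: "(nat list \<Rightarrow> nat set set) \<Rightarrow> nat set set \<Rightarrow> bool" where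
  "independent f J \<longleftrightarrow>
     (\<forall>s V Q E. V \<in> f s \<longrightarrow> finite Q \<longrightarrow> Q \<inter> J = {} \<longrightarrow> E \<in> cylinder Q \<longrightarrow> V \<inter> E \<noteq> {})"

lemma independentD:
  "independent f J \<Longrightarrow> V \<in> f s \<Longrightarrow> finite Q \<Longrightarrow> Q \<inter> J = {} \<Longrightarrow> E \<in> cylinder Q \<Longrightarrow> V \<inter> E \<noteq> {}"
  by (simp add: independent_def)

text \<open>On the bar only boundedness is asked for, as a filter need not choose a value; an
  ultrafilter will single out one value of a bounded \<open>\<pi>\<close>. Both alternatives persist
  when the filters grow.\<close>

definition settled :: "(nat \<Rightarrow> nat) \<Rightarrow> (nat list \<Rightarrow> nat set set) \<Rightarrow> bool" where
  "settled \<pi> f \<longleftrightarrow>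
     barred U (\<lambda>s. \<exists>m. {d. \<pi> d \<le> m} \<in> f s) [] \<or>
     (\<exists>W :: nat set \<Rightarrow> nat set. (\<forall>a. W a \<in> f []) \<and>
        (\<forall>n \<Lambda>. finite \<Lambda> \<longrightarrow> card \<Lambda> = Suc n \<longrightarrow> finite {d. \<pi> d = n \<and> (\<forall>a\<in>\<Lambda>. d \<in> W a)}))"

lemma settled_mono: "settled \<pi> f \<Longrightarrow> f \<le> g \<Longrightarrow> settled \<pi> g"
  unfolding settled_def le_fun_def by (elim disjE) (blast intro: barred_mono)+

lemma independent_adjoin:
  assumes "independent f J" "J \<subseteq> J'"
    and "\<And>s V C Q E. s \<in> P \<Longrightarrow> V \<in> f s \<Longrightarrow> C \<in> \<W> \<Longrightarrow> finite Q \<Longrightarrow> Q \<inter> J' = {} \<Longrightarrow> E \<in> cylinder Q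
      \<Longrightarrow> V \<inter> C \<inter> E \<noteq> {}"
  shows "independent (adjoin f P \<W>) J'"
  unfolding independent_def
proof (intro allI impI)
  fix s V Q E
  assume V: "V \<in> adjoin f P \<W> s" and Q: "finite Q" "Q \<inter> J' = {}" and E: "E \<in> cylinder Q"
  show "V \<inter> E \<noteq> {}"
  proof (cases "s \<in> P")
    case True
    then obtain V' C where "V' \<in> f s" "C \<in> \<W>" "V' \<inter> C \<subseteq> V" using V by (auto simp: adjoin_def)
    then show ?thesis using assms(3)[OF True _ _ Q E, of V' C] by blast
  next
    case False
    then have "V \<in> f s" using V by (simp add: adjoin_def)
    then show ?thesis using independentD[OF assms(1) _ Q(1) _ E] Q(2) assms(2) by blast
  qed
qed

text \<open>Compatibility has the same form as in \<open>independent_adjoin\<close>, so one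
  verification serves both; the cylinder over no rows gives
  \<open>V \<inter> C \<noteq> {}\<close>.\<close>

lemma system_adjoin:
  assumes f: "system f"
    and P: "\<And>s. s \<in> P \<Longrightarrow> {n. s @ [n] \<in> P} \<in> U"
    and W: "\<W> \<noteq> {}" "\<And>C C'. C \<in> \<W> \<Longrightarrow> C' \<in> \<W> \<Longrightarrow> C \<inter> C' \<in> \<W>"
    and compat: "\<And>s V C Q E. s \<in> P \<Longrightarrow> V \<in> f s \<Longrightarrow> C \<in> \<W> \<Longrightarrow> finite Q \<Longrightarrow> Q \<inter> J' = {} \<Longrightarrow> E \<in> cylinder Q
      \<Longrightarrow> V \<inter> C \<inter> E \<noteq> {}"
  shows "system (adjoin f P \<W>)"
proof -
  have "V \<inter> C \<noteq> {}" if "s \<in> P" "V \<in> f s" "C \<in> \<W>" for s V C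
    using compat[OF that _ _ cylinder_empty] by auto
  then have "coherent U (adjoin f P \<W>)"
    using f by (intro coherent_adjoin[OF UF _ P W]) (auto simp: system_def)
  moreover have "subtree s \<in> adjoin f P \<W> s" for s
    using f adjoin_ge[OF W(1)] unfolding system_def by blast
  ultimately show ?thesis by (simp add: system_def)
qed

section \<open>Settling one partition\<close>

text \<open>A node is boundable if some cylinder over unspent rows forces a bound on
  \<open>\<pi>\<close> there. If boundable nodes bar the root, such cylinders are adjoined, at the
  cost of countably many rows. Otherwise the single row \<open>i\<close>, read at level
  \<open>\<pi> d\<close>, yields the sets \<open>W a\<close>.\<close>

lemma settle:
  assumes f: "system f" and J: "independent f J" and i: "i \<notin> J"
  shows "\<exists>g j. f \<le> g \<and> system g \<and> countable j \<and> independent g (J \<union> j) \<and> settled \<pi> g"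
proof -
  have coh: "coherent U f" and subtree: "subtree s \<in> f s" for s using f by (auto simp: system_def)
  note fs = coherent_fil[OF coh]
  define boundable where "boundable s Q E m \<longleftrightarrow>
    finite Q \<and> Q \<inter> J = {} \<and> E \<in> cylinder Q \<and> - E \<union> {d. \<pi> d \<le> m} \<in> f s" for s Q E m
  define bd where "bd s \<longleftrightarrow> (\<exists>Q E m. boundable s Q E m)" for s
  have bd_children: "{n. bd (s @ [n])} \<in> U" if bd: "bd s" for s
  proof -
    obtain Q E m where b: "boundable s Q E m" using bd by (auto simp: bd_def)
    then have "{n. - E \<union> {d. \<pi> d \<le> m} \<in> f (s @ [n])} \<in> U"
      using coherentD[OF coh] by (simp add: boundable_def)
    then show ?thesis
      by (rule fil_mono[OF UF]) (use b in \<open>auto simp: bd_def boundable_def\<close>)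
  qed
  show ?thesis
  proof (cases "barred U bd []")
    case True
    have "\<forall>s. \<exists>Q E m. bd s \<longrightarrow> boundable s Q E m" by (auto simp: bd_def)
    then obtain Q E m where QE: "\<And>s. bd s \<Longrightarrow> boundable s (Q s) (E s) (m s)" by metis
    define j where "j = (\<Union>s\<in>{s. bd s}. Q s)"
    \<comment> \<open>On each branch only the first boundable node imposes its restriction.\<close>
    define fst_bd where "fst_bd t = take (LEAST k. bd (take k t)) t" for t
    \<comment> \<open>\<open>coherent_adjoin\<close> wants the same sets at all nodes. Inside the
      subtree of a boundable \<open>t\<close>, this \<open>C\<close> agrees with the one cylinder
      \<open>E (fst_bd t)\<close>, by \<open>fst_subtree\<close>.\<close>
    define C where "C = {d. d \<in> E (fst_bd (\<tau> d))}"
    have bd_fst: "bd (fst_bd t)" if "bd t" for t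
      unfolding fst_bd_def using LeastI[of "\<lambda>k. bd (take k t)" "length t"] that by simp
    have fst_subtree: "fst_bd (\<tau> d) = fst_bd t" if t: "bd t" and d: "d \<in> subtree t" for t d
    proof -
      have tk: "take k (\<tau> d) = take k t" if "k \<le> length t" for k
        using d that by (metis (mono_tags) subtree_def mem_Collect_eq min.absorb1 take_take)
      have le: "(LEAST k. bd (take k t)) \<le> length t" using t by (intro Least_le) simp
      have "(LEAST k. bd (take k (\<tau> d))) = (LEAST k. bd (take k t))"
      proof (rule Least_equality)
        show "bd (take (LEAST k. bd (take k t)) (\<tau> d))"
          using tk[OF le] bd_fst[OF t] by (simp add: fst_bd_def)
        show "(LEAST k. bd (take k t)) \<le> k" if "bd (take k (\<tau> d))" for k
        proof (cases "k \<le> length t")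
          case True
          then show ?thesis using that tk by (intro Least_le) simp
        qed (use le in simp)
      qed
      then show ?thesis using tk[OF le] by (simp add: fst_bd_def)
    qed
    \<comment> \<open>\<open>V\<close> is followed down to a boundable \<open>t\<close>. There
      independence meets both cylinders at once, because the rows in \<open>Q'\<close> avoid
      \<open>j\<close>.\<close>
    have compat: "V \<inter> C' \<inter> E' \<noteq> {}"
      if s: "s \<in> {s. barred U bd s}" and V: "V \<in> f s" and "C' \<in> {C}"
        and Q': "finite Q'" "Q' \<inter> (J \<union> j) = {}" and E': "E' \<in> cylinder Q'" for s V C' Q' E'
    proof -
      obtain t where t: "bd t" "V \<in> f t" using barred_hit[OF UF coh _ V] s by blast
      have b: "boundable (fst_bd t) (Q (fst_bd t)) (E (fst_bd t)) (m (fst_bd t))"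
        using QE bd_fst t(1) by blast
      have "Q (fst_bd t) \<inter> Q' = {}" using Q'(2) bd_fst[OF t(1)] by (auto simp: j_def)
      then have "E (fst_bd t) \<inter> E' \<in> cylinder (Q (fst_bd t) \<union> Q')"
        using cylinder_Int[OF _ E'] b by (simp add: boundable_def)
      then have "(V \<inter> subtree t) \<inter> (E (fst_bd t) \<inter> E') \<noteq> {}"
        using b Q' by (intro independentD[OF J fil_Int[OF fs t(2) subtree]]) (auto simp: boundable_def)
      then obtain d where "d \<in> V" "d \<in> subtree t" "d \<in> E (fst_bd t)" "d \<in> E'" by blast
      then have "d \<in> V \<inter> C \<inter> E'" using fst_subtree[OF t(1)] by (simp add: C_def)
      then show ?thesis using \<open>C' \<in> {C}\<close> by blast
    qed
    let ?g = "adjoin f {s. barred U bd s} {C}"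
    have "system ?g"
      by (rule system_adjoin[OF f _ _ _ compat]) (use barred_children[OF UF bd_children] in auto)
    moreover have "independent ?g (J \<union> j)"
      by (rule independent_adjoin[OF J _ compat]) auto
    moreover have "countable j"
      unfolding j_def using QE by (intro countable_UN) (auto simp: boundable_def intro: countable_finite)
    moreover have "f \<le> ?g" by (simp add: le_fun_def adjoin_ge)
    moreover have "settled \<pi> ?g"
    proof -
      have "\<exists>m. {d. \<pi> d \<le> m} \<in> ?g s" if s: "bd s" and first: "\<forall>k<length s. \<not> bd (take k s)" for s
      proof -
        have "(LEAST k. bd (take k s)) = length s"
          using s first by (intro Least_equality) (auto simp: not_less[symmetric])
        then have eq: "fst_bd s = s" by (simp add: fst_bd_def)
        have "- E s \<union> {d. \<pi> d \<le> m s} \<in> f s" using QE[OF s] by (simp add: boundable_def)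
        then have "(- E s \<union> {d. \<pi> d \<le> m s}) \<inter> subtree s \<in> f s" using fil_Int[OF fs _ subtree] by blast
        \<comment> \<open>Inside the subtree of \<open>s\<close> the set \<open>C\<close> is
          contained in \<open>E s\<close>, which removes the alternative \<open>- E s\<close> and
          leaves the bound.\<close>
        moreover have "(- E s \<union> {d. \<pi> d \<le> m s}) \<inter> subtree s \<inter> C \<subseteq> {d. \<pi> d \<le> m s}"
          using fst_subtree[OF s] eq by (auto simp: C_def)
        ultimately have "{d. \<pi> d \<le> m s} \<in> ?g s"
          using barred.base[of bd s U, OF s] unfolding adjoin_def by auto
        then show ?thesis by blast
      qed
      then have "barred U (\<lambda>s. \<exists>m. {d. \<pi> d \<le> m} \<in> ?g s) []"
        using barred_mono[OF barred_first[OF True]] by simp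
      then show ?thesis by (simp add: settled_def)
    qed
    ultimately show ?thesis by blast
  next
    case False
    \<comment> \<open>On \<open>\<pi> d = n\<close> this is the level-\<open>n\<close> set of column
      \<open>a\<close>, so \<open>thin\<close> gives the finiteness that \<open>settled\<close>
      demands.\<close>
    define W where "W a = {d. d \<in> A i a (\<pi> d)}" for a
    define \<W> where "\<W> = {{d. \<forall>a\<in>\<Lambda>. d \<in> W a} |\<Lambda>. finite \<Lambda>}"
    have inW: "{d. \<forall>a\<in>\<Lambda>. d \<in> W a} \<in> \<W>" if "finite \<Lambda>" for \<Lambda>
      using that by (auto simp: \<W>_def)
    have Int: "C \<inter> C' \<in> \<W>" if C: "C \<in> \<W>" "C' \<in> \<W>" for C C'
    proof -
      obtain \<Lambda> \<Lambda>' where "finite \<Lambda>" "finite \<Lambda>'" "C = {d. \<forall>a\<in>\<Lambda>. d \<in> W a}" "C' = {d. \<forall>a\<in>\<Lambda>'. d \<in> W a}"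
        using C by (auto simp: \<W>_def)
      then show ?thesis using inW[of "\<Lambda> \<union> \<Lambda>'"] by (simp add: ball_Un Collect_conj_eq)
    qed
    have compat: "V \<inter> C \<inter> E \<noteq> {}"
      if s: "s \<in> {s. \<not> barred U bd s}" and V: "V \<in> f s" and C: "C \<in> \<W>"
        and Q: "finite Q" "Q \<inter> (J \<union> {i}) = {}" and E: "E \<in> cylinder Q" for s V C Q E
    proof -
      obtain \<Lambda> where \<Lambda>: "finite \<Lambda>" "C = {d. \<forall>a\<in>\<Lambda>. d \<in> W a}" using C by (auto simp: \<W>_def)
      \<comment> \<open>As the node is not boundable, \<open>E'\<close> cannot force
        \<open>\<pi>\<close> below \<open>card \<Lambda>\<close>: inside \<open>V\<close> it has a
        point whose level \<open>\<pi> d\<close> is high enough for all columns in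
        \<open>\<Lambda>\<close>.\<close>
      define E' where "E' = E \<inter> {d. \<forall>a\<in>\<Lambda>. d \<in> A i a (card \<Lambda>)}"
      have E': "E' \<in> cylinder (Q \<union> {i})"
        unfolding E'_def using cylinder_Int[OF E cylinder_single[OF \<Lambda>(1)]] Q(2) by blast
      have "\<not> boundable s (Q \<union> {i}) E' (card \<Lambda>)"
        using s barred.base[of bd s U] by (auto simp: bd_def)
      then have "- E' \<union> {d. \<pi> d \<le> card \<Lambda>} \<notin> f s"
        using Q i E' by (auto simp: boundable_def)
      then have "\<not> V \<subseteq> - E' \<union> {d. \<pi> d \<le> card \<Lambda>}" using fil_mono[OF fs V] by blast
      then obtain d where "d \<in> V" "d \<in> E'" "\<not> \<pi> d \<le> card \<Lambda>" by blast
      then have d: "d \<in> V" "d \<in> E'" "card \<Lambda> \<le> \<pi> d" by simp_all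
      \<comment> \<open>This is where monotonicity in the last index is needed: \<open>\<pi> d\<close> is only bounded below.\<close>
      have "d \<in> C" unfolding \<Lambda>(2) W_def using d(2) mono[OF d(3)] by (auto simp: E'_def)
      then show ?thesis using d by (auto simp: E'_def)
    qed
    let ?g = "adjoin f {s. \<not> barred U bd s} \<W>"
    have ne: "\<W> \<noteq> {}" using inW[of "{}"] by blast
    have "system ?g"
      by (rule system_adjoin[where J' = "J \<union> {i}", OF f _ ne Int compat]) (use not_barred[OF U] in auto)
    moreover have "independent ?g (J \<union> {i})"
      by (rule independent_adjoin[OF J _ compat]) auto
    moreover have "f \<le> ?g" by (simp add: le_fun_def adjoin_ge ne)
    moreover have "settled \<pi> ?g"
    proof -
      have "W a \<in> ?g []" for a
        using adjoin_mem[where f = f, OF fs, of "[]" "{s. \<not> barred U bd s}" "W a" \<W>] False inW[of "{a}"]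
        by simp
      moreover have "finite {d. \<pi> d = n \<and> (\<forall>a\<in>\<Lambda>. d \<in> W a)}"
        if "finite \<Lambda>" "card \<Lambda> = Suc n" for n \<Lambda>
        by (rule finite_subset[OF _ thin[OF that, of i]]) (auto simp: W_def)
      ultimately show ?thesis unfolding settled_def by blast
    qed
    ultimately show ?thesis by (meson countable_finite finite.emptyI finite_insert)
  qed
qed

section \<open>The transfinite recursion over all partitions\<close>

text \<open>A proper initial segment has fewer than continuum many stages, and countably many rows
  per stage keep the total below the continuum.\<close>

lemma unused_row:
  includes cardinal_syntax
  fixes j :: "nat set \<Rightarrow> nat set set"
  assumes "\<And>b. b \<in> underS |UNIV :: nat set set| a \<Longrightarrow> countable (j b)"
  shows "\<exists>i. i \<notin> (\<Union>b\<in>underS |UNIV :: nat set set| a. j b)"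
proof -
  let ?S = "underS |UNIV :: nat set set| a" and ?N = "UNIV :: nat set"
  \<comment> \<open>The summand \<open>?N\<close> keeps the bound infinite when \<open>?S\<close> is
    finite, and it dominates each countable \<open>j b\<close>.\<close>
  let ?B = "?S <+> ?N"
  have inf: "infinite ?B" by simp
  have S: "|?S| <o |UNIV :: nat set set|" by (rule card_of_underS[OF card_of_Card_order]) (simp add: Field_card_of)
  have N: "|?N| <o |UNIV :: nat set set|" using card_of_Pow[of ?N] by simp
  have "infinite (UNIV :: nat set set)" by (metis Finite_Set.finite_set infinite_UNIV_nat)
  then have B: "|?B| <o |UNIV :: nat set set|" by (rule card_of_Plus_ordLess_infinite[OF _ S N])
  have "|j b| \<le>o |?B|" if "b \<in> ?S" for b
  proof -
    obtain h where "inj_on h (j b)" "h ` j b \<subseteq> ?N" by (metis assms \<open>b \<in> ?S\<close> countableE subset_UNIV)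
    then have "|j b| \<le>o |?N|" using card_of_ordLeq by blast
    also have "|?N| \<le>o |?B|" by (rule card_of_Plus2)
    finally show ?thesis .
  qed
  then have "|\<Union>b\<in>?S. j b| \<le>o |?B|"
    by (intro card_of_UNION_ordLeq_infinite[OF inf card_of_Plus1]) blast
  then have "|\<Union>b\<in>?S. j b| <o |UNIV :: nat set set|" using B ordLeq_ordLess_trans by blast
  then have "(\<Union>b\<in>?S. j b) \<noteq> UNIV" using ordLess_irreflexive by fastforce
  then show ?thesis by blast
qed

lemma base_system:
  defines "f0 \<equiv> \<lambda>s. {V. subtree s \<subseteq> V}"
  shows "system f0" "independent f0 J"
proof -
  have ne: "subtree s \<noteq> {}" for s using subtree_Int_cylinder[OF _ cylinder_empty] by blast
  have "fil (f0 s)" for s using ne[of s] by (auto simp: fil_def f0_def)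
  moreover have "{n. V \<in> f0 (s @ [n])} \<in> U" if "V \<in> f0 s" for s V
  proof -
    have "{n. V \<in> f0 (s @ [n])} = UNIV" using that subtree_append by (fastforce simp: f0_def)
    then show ?thesis using fil_UNIV[OF UF] by simp
  qed
  ultimately show "system f0" by (simp add: system_def coherent_def) (simp add: f0_def)
  show "independent f0 J"
    unfolding independent_def f0_def using subtree_Int_cylinder by blast
qed

lemma settled_system_exists:
  includes cardinal_syntax
  obtains f where "system f" "\<And>\<pi>. settled \<pi> f"
proof -
  let ?r = "|UNIV :: nat set set|"
  have wo: "Well_order ?r" by (rule card_of_Well_order)
  have fld: "Field ?r = UNIV" by (rule Field_card_of)
  have wf: "wf (?r - Id)" using wo by (simp add: well_order_on_def)
  have lin: "(a, b) \<in> ?r - Id \<or> a = b \<or> (b, a) \<in> ?r - Id" for a b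
    using wo fld unfolding well_order_on_def linear_order_on_def total_on_def by blast
  \<comment> \<open>Every set of naturals is read as the code of a function, and the coded graph of
    \<open>p\<close> yields \<open>p\<close>. So stages indexed by sets of naturals reach all
    partitions.\<close>
  define \<pi> :: "nat set \<Rightarrow> nat \<Rightarrow> nat" where "\<pi> S n = (LEAST m. prod_encode (n, m) \<in> S)" for S n
  have \<pi>: "\<exists>S. \<pi> S = p" for p
    by (rule exI[of _ "{prod_encode (n, p n) |n. True}"])
      (auto simp: \<pi>_def intro!: ext Least_equality)
  define below where "below F a = (\<Union>b\<in>underS ?r a. snd (F b))"
    for F :: "nat set \<Rightarrow> (nat list \<Rightarrow> nat set set) \<times> nat set set" and a
  \<comment> \<open>A stage outputs its system and the rows it spends; independence is kept modulo
    these and the rows of earlier stages.\<close>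
  define P where "P F a out \<longleftrightarrow> system (fst out) \<and> (\<forall>b\<in>underS ?r a. fst (F b) \<le> fst out) \<and>
      countable (snd out) \<and> independent (fst out) (below F a \<union> snd out) \<and> settled (\<pi> a) (fst out)"
    for F a and out :: "(nat list \<Rightarrow> nat set set) \<times> nat set set"
  have "\<exists>F. \<forall>a. P F a (F a)"
  proof (rule dependent_wf_choice[OF wf])
    fix F G :: "nat set \<Rightarrow> (nat list \<Rightarrow> nat set set) \<times> nat set set" and a out
    assume "\<And>z. (z, a) \<in> ?r - Id \<Longrightarrow> F z = G z"
    then have "F z = G z" if "z \<in> underS ?r a" for z using that by (simp add: underS_def)
    then show "P F a out = P G a out" by (simp add: P_def below_def)
  next
    fix a F assume "\<And>y. (y, a) \<in> ?r - Id \<Longrightarrow> P F y (F y)"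
    then have IH: "P F b (F b)" if "b \<in> underS ?r a" for b using that by (simp add: underS_def)
    \<comment> \<open>The base system makes the union nonempty at the first stage. It lies below
      every system, so the family remains a chain.\<close>
    define \<F> where "\<F> = insert (\<lambda>s. {V. subtree s \<subseteq> V}) ((fst \<circ> F) ` underS ?r a)"
    have sys: "system f" if "f \<in> \<F>" for f
      using that IH base_system(1) by (auto simp: \<F>_def P_def)
    have trans: "underS ?r b \<subseteq> underS ?r a" if "b \<in> underS ?r a" for b
    proof -
      have "trans ?r" "antisym ?r"
        using wo by (auto simp: order_on_defs)
      moreover have "(b, a) \<in> ?r" using that by (simp add: underS_def)
      ultimately show ?thesis by (rule Order_Relation.underS_incr)
    qed
    have ind: "independent f (below F a)" if f: "f \<in> \<F>" for f
    proof -
      have "independent (fst (F b)) (below F a)" if b: "b \<in> underS ?r a" for b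
      proof -
        have "below F b \<union> snd (F b) \<subseteq> below F a" using trans[OF b] b by (auto simp: below_def)
        then show ?thesis using IH[OF b] unfolding P_def independent_def by blast
      qed
      then show ?thesis using f base_system(2) by (auto simp: \<F>_def)
    qed
    define f where "f s = (\<Union>g\<in>\<F>. g s)" for s
    have chain: "g \<le> h \<or> h \<le> g" if gh: "g \<in> \<F>" "h \<in> \<F>" for g h
    proof -
      have "(\<lambda>s. {V. subtree s \<subseteq> V}) \<le> g" if "system g" for g
      proof (rule le_funI, rule subsetI)
        fix s V assume "V \<in> {V. subtree s \<subseteq> V}"
        then show "V \<in> g s"
          using that fil_mono[OF coherent_fil, of U g "subtree s" s V] by (simp add: system_def)
      qed
      moreover have "fst (F b) \<le> fst (F c) \<or> fst (F c) \<le> fst (F b)"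
        if "b \<in> underS ?r a" "c \<in> underS ?r a" for b c
      proof -
        have "b \<in> underS ?r c \<or> b = c \<or> c \<in> underS ?r b" using lin[of b c] by (auto simp: underS_def)
        then show ?thesis using IH[OF that(1)] IH[OF that(2)] by (auto simp: P_def)
      qed
      ultimately show ?thesis using gh sys[OF gh(1)] sys[OF gh(2)] unfolding \<F>_def by auto
    qed
    have "coherent U f"
      unfolding f_def by (rule coherent_UN[OF UF _ _ chain]) (use sys in \<open>auto simp: \<F>_def system_def\<close>)
    then have 1: "system f" by (auto simp: system_def f_def \<F>_def)
    have 2: "independent f (below F a)"
      using ind unfolding independent_def f_def by blast
    obtain i where "i \<notin> below F a"
      using unused_row[of a "\<lambda>b. snd (F b)"] IH unfolding below_def P_def by blast
    from settle[OF 1 2 this] obtain g j where g: "f \<le> g" "system g" "countable j"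
        "independent g (below F a \<union> j)" "settled (\<pi> a) g" by blast
    have "fst (F b) \<le> g" if "b \<in> underS ?r a" for b
    proof -
      have "fst (F b) \<in> \<F>" using that by (auto simp: \<F>_def)
      then have "fst (F b) \<le> f" by (auto simp: f_def le_fun_def)
      then show ?thesis using g(1) by (rule order_trans)
    qed
    then have "P F a (g, j)" using g by (simp add: P_def)
    then show "\<exists>out. P F a out" by blast
  qed
  then obtain F where F: "\<And>a. P F a (F a)" by blast
  define f where "f s = (\<Union>g\<in>range (fst \<circ> F). g s)" for s
  have le: "fst (F a) \<le> f" for a by (auto simp: f_def le_fun_def)
  have "coherent U f"
    unfolding f_def
  proof (rule coherent_UN[OF UF])
    show "coherent U g" if "g \<in> range (fst \<circ> F)" for g
      using that F by (auto simp: P_def system_def)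
    fix g h assume "g \<in> range (fst \<circ> F)" "h \<in> range (fst \<circ> F)"
    then obtain b c where gh: "g = fst (F b)" "h = fst (F c)" by auto
    have "b \<in> underS ?r c \<or> b = c \<or> c \<in> underS ?r b" using lin[of b c] by (auto simp: underS_def)
    then show "g \<le> h \<or> h \<le> g" using F[of b] F[of c] by (auto simp: P_def gh)
  qed simp
  moreover have "subtree s \<in> f s" for s
    using F[of "{}"] le_funD[OF le, of "{}" s] by (auto simp: P_def system_def)
  ultimately have "system f" by (simp add: system_def)
  moreover have "settled p f" for p
  proof -
    obtain a where "\<pi> a = p" using \<pi> by blast
    then show ?thesis using F[of a] settled_mono[OF _ le] by (auto simp: P_def)
  qed
  ultimately show thesis by (rule that)
qed

lemma settled_ultra_system_exists:
  obtains x where "system x" "\<And>s. ultra (x s)" "\<And>\<pi>. settled \<pi> x"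
proof -
  obtain f where f: "system f" "\<And>\<pi>. settled \<pi> f" by (rule settled_system_exists) blast
  then obtain x where x: "coherent U x" "f \<le> x" "\<And>s. ultra (x s)"
    using coherent_ultra[OF U, of f] by (auto simp: system_def)
  have "subtree s \<in> x s" for s using f(1) le_funD[OF x(2), of s] by (auto simp: system_def)
  then show thesis using that[of x] x settled_mono[OF f(2) x(2)] by (simp add: system_def)
qed

end

section \<open>Ultrafilters on a set\<close>

lemma filter_onD:
  assumes "filter_on K F"
  shows filter_on_sub: "A \<in> F \<Longrightarrow> A \<subseteq> K" and filter_on_UNIV: "K \<in> F" and filter_on_empty: "{} \<notin> F"
    and filter_on_Int: "A \<in> F \<Longrightarrow> B \<in> F \<Longrightarrow> A \<inter> B \<in> F"
    and filter_on_mono: "A \<in> F \<Longrightarrow> A \<subseteq> B \<Longrightarrow> B \<subseteq> K \<Longrightarrow> B \<in> F"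
  using assms unfolding filter_on_def by blast+

lemma beta_filter_on: "x \<in> beta K \<Longrightarrow> filter_on K x"
  by (simp add: beta_def)

lemma remainder_beta: "x \<in> beta_remainder K \<Longrightarrow> x \<in> beta K"
  by (simp add: beta_remainder_def)

lemma remainder_finite:
  assumes x: "x \<in> beta_remainder K" and "finite A"
  shows "A \<notin> x"
  using assms(2)
proof induction
  note F = beta_filter_on[OF remainder_beta[OF x]]
  case empty
  show ?case by (rule filter_on_empty[OF F])
next
  note F = beta_filter_on[OF remainder_beta[OF x]]
  case (insert a A)
  show ?case
  proof
    assume ins: "insert a A \<in> x"
    then have aK: "a \<in> K" "A \<subseteq> K" using filter_on_sub[OF F] by blast+
    then have "K - A \<in> x" using insert.IH x by (auto simp: beta_remainder_def beta_def)
    from filter_on_Int[OF F ins this] have "{a} \<in> x"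
      by (rule filter_on_mono[OF F]) (use aK in auto)
    then have "a \<in> B" if "B \<in> x" for B
      using filter_on_Int[OF F _ that, of "{a}"] filter_on_empty[OF F] by (cases "a \<in> B") auto
    then have "x = principal_at K a"
      using filter_on_sub[OF F] filter_on_mono[OF F \<open>{a} \<in> x\<close>] by (auto simp: principal_at_def)
    then show False using x aK by (simp add: beta_remainder_def)
  qed
qed

lemma filter_on_finite_INT:
  assumes "filter_on K x" "finite I" "\<And>i. i \<in> I \<Longrightarrow> S i \<in> x"
  shows "{d \<in> K. \<forall>i\<in>I. d \<in> S i} \<in> x"
  using assms(2,3)
proof induction
  case empty
  then show ?case using filter_on_UNIV[OF assms(1)] by simp
next
  case (insert i I)
  then have "{d \<in> K. \<forall>i\<in>I. d \<in> S i} \<inter> S i \<in> x" by (intro filter_on_Int[OF assms(1)]) auto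
  then show ?case by (rule back_subst) auto
qed

text \<open>An ultrafilter contains \<open>A \<inter> A'\<close> iff it contains both sets, so the
  subbasic sets are closed under intersection and form a base on which closure can be
  tested.\<close>

lemma closure_of_betaI:
  assumes G: "G \<in> beta K" and "\<And>A. A \<in> G \<Longrightarrow> \<exists>x\<in>S. A \<in> x" and S: "S \<subseteq> beta K"
  shows "G \<in> beta_topology K closure_of S"
proof -
  let ?B = "{{x \<in> beta K. A \<in> x} |A. A \<subseteq> K}"
  have nbhd: "\<exists>A\<in>x. {y \<in> beta K. A \<in> y} \<subseteq> T" if "generate_topology_on ?B T" "x \<in> T" "x \<in> beta K" for T x
    using that
  proof (induction arbitrary: x)
    case (Int T T')
    then obtain A A' where "A \<in> x" "{y \<in> beta K. A \<in> y} \<subseteq> T" "A' \<in> x" "{y \<in> beta K. A' \<in> y} \<subseteq> T'"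
      by blast
    moreover have "A \<in> y" "A' \<in> y" if "y \<in> beta K" "A \<inter> A' \<in> y" "A \<subseteq> K" "A' \<subseteq> K" for y
      using filter_on_mono[OF beta_filter_on[OF that(1)] that(2)] that by auto
    moreover have "A \<subseteq> K" "A' \<subseteq> K" "A \<inter> A' \<in> x"
      using filter_on_sub[OF beta_filter_on[OF Int.prems(2)]] filter_on_Int[OF beta_filter_on[OF Int.prems(2)]] calculation
      by blast+
    ultimately show ?case by (intro bexI[of _ "A \<inter> A'"]) auto
  next
    case (UN \<T>)
    then show ?case by (meson UnionE Union_upper order_trans)
  qed auto
  have "G \<in> topspace (beta_topology K)"
    using G filter_on_UNIV[OF beta_filter_on[OF G]]
    by (auto simp: beta_topology_def topology_generated_by_topspace)
  moreover have "\<exists>x. x \<in> S \<and> x \<in> T" if T: "G \<in> T" "openin (beta_topology K) T" for T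
  proof -
    have "generate_topology_on ?B T"
      using T(2) openin_topology_generated_by unfolding beta_topology_def by blast
    then obtain A where A: "A \<in> G" "{y \<in> beta K. A \<in> y} \<subseteq> T" using nbhd T(1) G by blast
    then show ?thesis using assms(2)[OF A(1)] S by blast
  qed
  ultimately show ?thesis by (simp add: in_closure_of)
qed

text \<open>The part of \<open>K\<close> left uncovered by the disjoint sets is given to the index
  \<open>a0\<close>.\<close>

lemma discrete_enumI:
  assumes X: "\<And>a. a \<in> K \<Longrightarrow> filter_on K (X a)"
    and P: "disjoint_family_on P K" "\<And>a. a \<in> K \<Longrightarrow> P a \<in> X a" and a0: "a0 \<in> K"
  shows "discrete_enum K X"
proof -
  define A where "A a = P a \<union> (if a = a0 then K - (\<Union>c\<in>K. P c) else {})" for a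
  have PK: "P a \<subseteq> K" if "a \<in> K" for a using filter_on_sub[OF X P(2)] that by blast
  have "disjoint_family_on A K"
    using P(1) unfolding disjoint_family_on_def A_def by auto
  moreover have "(\<Union>a\<in>K. A a) = K"
  proof
    show "(\<Union>a\<in>K. A a) \<subseteq> K" using PK by (auto simp: A_def split: if_splits)
    have "K - (\<Union>a\<in>K. P a) \<subseteq> A a0" "P a \<subseteq> A a" for a by (auto simp: A_def)
    then show "K \<subseteq> (\<Union>a\<in>K. A a)" using a0 by blast
  qed
  moreover have "A a \<in> X a" if "a \<in> K" for a
    by (rule filter_on_mono[OF X P(2)]) (use that PK in \<open>auto simp: A_def\<close>)
  ultimately show ?thesis using X unfolding discrete_enum_def by blast
qed

section \<open>Copies of the naturals inside \<open>K\<close>\<close>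

definition push :: "'a set \<Rightarrow> (nat \<Rightarrow> 'a) \<Rightarrow> nat set set \<Rightarrow> 'a set set" where
  "push K e z = {A. A \<subseteq> K \<and> e -` A \<in> z}"

lemma push_remainder:
  assumes e: "inj e" "range e \<subseteq> K" and z: "ultra z" "\<And>n. {n} \<notin> z"
  shows "push K e z \<in> beta_remainder K"
proof -
  note F = ultra_fil[OF z(1)]
  have eK: "e -` K = UNIV" using e by auto
  have "filter_on K (push K e z)"
    unfolding filter_on_def push_def
    using eK fil_UNIV[OF F] fil_empty[OF F] fil_Int[OF F] fil_mono[OF F _ vimage_mono] by auto
  moreover have "A \<in> push K e z \<or> K - A \<in> push K e z" if "A \<subseteq> K" for A
  proof -
    have "e -` (K - A) = - (e -` A)" using eK by auto
    then show ?thesis using that ultra_Compl_iff[OF z(1)] by (auto simp: push_def)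
  qed
  moreover have "push K e z \<noteq> principal_at K a" if "a \<in> K" for a
  proof
    assume "push K e z = principal_at K a"
    then have "{a} \<in> push K e z" using that by (simp add: principal_at_def)
    then show False
      using ultra_finite[OF z finite_vimageI[OF _ e(1)], of "{a}"] by (simp add: push_def)
  qed
  ultimately show ?thesis by (auto simp: beta_remainder_def beta_def)
qed

text \<open>\<open>range e\<close> will carry the tree. A discrete family must be indexed by all of
  \<open>K\<close>, and the copies \<open>range (b a)\<close> make room for its remaining
  members.\<close>

locale split_set =
  fixes K :: "'a set" and e :: "nat \<Rightarrow> 'a" and b :: "'a \<Rightarrow> nat \<Rightarrow> 'a"
  assumes e: "inj e" "range e \<subseteq> K"
    and b: "a \<in> K \<Longrightarrow> inj (b a)" "a \<in> K \<Longrightarrow> range (b a) \<subseteq> K"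
    and b_e: "a \<in> K \<Longrightarrow> range (b a) \<inter> range e = {}"
    and b_b: "a \<in> K \<Longrightarrow> c \<in> K \<Longrightarrow> a \<noteq> c \<Longrightarrow> range (b a) \<inter> range (b c) = {}"

lemma split_set_exists:
  includes cardinal_syntax
  fixes K :: "'a set"
  assumes "infinite K"
  shows "\<exists>e b. split_set K e b"
proof -
  have "|UNIV :: nat set| \<le>o |K|" using assms infinite_iff_card_of_nat by blast
  then have "|K \<times> (UNIV :: nat set)| =o |K|" using card_of_Times_infinite[OF assms] by blast
  then obtain \<beta> where \<beta>: "bij_betw \<beta> (K \<times> (UNIV :: nat set)) K" using card_of_ordIso by blast
  have rng: "\<beta> (a, n) \<in> K" if "a \<in> K" for a n
    using that bij_betwE[OF \<beta>] by simp
  have eq: "\<beta> (a, m) = \<beta> (c, n) \<longleftrightarrow> a = c \<and> m = n" if "a \<in> K" "c \<in> K" for a c m n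
    using inj_on_eq_iff[OF bij_betw_imp_inj_on[OF \<beta>], of "(a, m)" "(c, n)"] that by simp
  obtain a0 where a0: "a0 \<in> K" using assms by fastforce
  \<comment> \<open>Even slots of \<open>a0\<close> serve \<open>e\<close>, odd slots of
    \<open>a\<close> serve \<open>b a\<close>; parity separates them when
    \<open>a = a0\<close>.\<close>
  have "split_set K (\<lambda>n. \<beta> (a0, 2 * n)) (\<lambda>a n. \<beta> (a, Suc (2 * n)))"
  proof
    show "range (\<lambda>n. \<beta> (a, Suc (2 * n))) \<inter> range (\<lambda>n. \<beta> (a0, 2 * n)) = {}" if "a \<in> K" for a
    proof -
      have "\<beta> (a, Suc (2 * m)) \<noteq> \<beta> (a0, 2 * n)" for m n
        using eq[OF that a0] by (simp add: Suc_double_not_eq_double)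
      then show ?thesis by auto
    qed
  qed (use a0 eq rng in \<open>auto simp: inj_on_def\<close>)
  then show ?thesis by blast
qed

context split_set
begin

text \<open>The given ultrafilters are filled up to a discrete family indexed by \<open>K\<close>.
  \<open>G\<close> is none of the added ones, since these contain a set \<open>range (b a)\<close>,
  whose preimage under \<open>e\<close> is empty.\<close>

lemma non_minimal_push:
  fixes z :: "nat list \<Rightarrow> nat set set"
  assumes z: "\<And>i. i \<in> I \<Longrightarrow> ultra (z i)" "\<And>i n. i \<in> I \<Longrightarrow> {n} \<notin> z i"
    and B: "disjoint_family_on B I" "\<And>i. i \<in> I \<Longrightarrow> B i \<in> z i"
    and G: "G \<in> beta_remainder K" "\<And>A. A \<in> G \<Longrightarrow> \<exists>i\<in>I. A \<in> push K e (z i)"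
    and ne: "\<And>i. i \<in> I \<Longrightarrow> G \<noteq> push K e (z i)"
  shows "non_minimal K G"
proof -
  obtain U :: "nat set set" where U: "ultra U" "\<And>n. {n} \<notin> U" using free_ultrafilter_exists by blast
  \<comment> \<open>The indices outside \<open>(\<lambda>i. e (to_nat i)) ` I\<close> carry free ultrafilters on the sets \<open>range (b a)\<close>.\<close>
  define idx where "idx a = (from_nat (inv e a) :: nat list)" for a
  have idx [simp]: "idx (e (to_nat i)) = i" for i using e(1) by (simp add: idx_def)
  define J where "J = (\<lambda>i. e (to_nat i)) ` I"
  have J: "idx a \<in> I" if "a \<in> J" for a using that by (auto simp: J_def)
  have idx_inj: "idx a \<noteq> idx c" if "a \<in> J" "c \<in> J" "a \<noteq> c" for a c
    using that by (auto simp: J_def)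
  define X where "X a = (if a \<in> J then push K e (z (idx a)) else push K (b a) U)" for a
  define P where "P a = (if a \<in> J then e ` B (idx a) else range (b a))" for a
  have X: "X a \<in> beta_remainder K" if "a \<in> K" for a
    using push_remainder[OF e z] push_remainder[OF b U] J that by (simp add: X_def)
  have P: "P a \<in> X a" if "a \<in> K" for a
  proof (cases "a \<in> J")
    case True
    then show ?thesis
      using B(2)[OF J[OF True]] e by (auto simp: P_def X_def push_def inj_vimage_image_eq)
  next
    case False
    moreover have "b a -` range (b a) = UNIV" by auto
    ultimately show ?thesis
      using b(2)[OF that] fil_UNIV[OF ultra_fil[OF U(1)]] by (simp add: P_def X_def push_def)
  qed
  have "disjoint_family_on P K"
    unfolding disjoint_family_on_def
  proof (intro ballI impI)
    fix a c assume ac: "a \<in> K" "c \<in> K" "a \<noteq> c"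
    have 1: "e ` B (idx a) \<inter> e ` B (idx c) = {}" if "a \<in> J" "c \<in> J"
    proof -
      have "B (idx a) \<inter> B (idx c) = {}"
        using B(1) J[OF that(1)] J[OF that(2)] idx_inj[OF that ac(3)] by (simp add: disjoint_family_on_def)
      then show ?thesis using e(1) by (simp add: image_Int[symmetric])
    qed
    have "e ` B i \<inter> range (b d) = {}" "range (b d) \<inter> e ` B i = {}" if "d \<in> K" for d i
      using b_e[OF that] by auto
    then show "P a \<inter> P c = {}" using 1 b_b[OF ac] ac by (simp add: P_def)
  qed
  then have "discrete_enum K X"
    using e(2) by (intro discrete_enumI[of K X P "e 0"] P beta_filter_on remainder_beta X) auto
  then have S: "discrete_filters K (X ` K)" unfolding discrete_filters_def by blast
  have "\<exists>x\<in>X ` K. A \<in> x" if A: "A \<in> G" for A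
  proof -
    obtain i where i: "i \<in> I" "A \<in> push K e (z i)" using G(2)[OF A] by blast
    then have "A \<in> X (e (to_nat i))" by (simp add: X_def J_def)
    then show ?thesis using e(2) by blast
  qed
  then have "G \<in> beta_topology K closure_of X ` K"
    using X remainder_beta by (intro closure_of_betaI remainder_beta[OF G(1)]) auto
  moreover have "G \<notin> X ` K"
  proof
    assume "G \<in> X ` K"
    then obtain a where a: "a \<in> K" "G = X a" by blast
    have aJ: "a \<notin> J"
    proof
      assume "a \<in> J"
      then show False using ne[OF J[OF \<open>a \<in> J\<close>]] a(2) by (simp add: X_def)
    qed
    then have "range (b a) \<in> G" using P[OF a(1)] a(2) by (simp add: P_def)
    then obtain i where i: "i \<in> I" "range (b a) \<in> push K e (z i)" using G(2) by blast
    moreover have "e -` range (b a) = {}" using b_e[OF a(1)] by auto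
    ultimately show False using fil_empty[OF ultra_fil[OF z(1)[OF i(1)]]] by (simp add: push_def)
  qed
  ultimately show ?thesis
    unfolding non_minimal_def using G(1) S X by (intro conjI exI[of _ "X ` K"]) auto
qed

end

section \<open>The Simon point\<close>

context linked_tree
begin

lemma subtree_disjoint:
  assumes "k \<le> length s" "k \<le> length t" "take k s \<noteq> take k t"
  shows "subtree s \<inter> subtree t = {}"
proof (rule ccontr)
  assume "\<not> ?thesis"
  then obtain d where "take (length s) (\<tau> d) = s" "take (length t) (\<tau> d) = t"
    by (auto simp: subtree_def)
  then have "take k s = take k (\<tau> d)" "take k t = take k (\<tau> d)"
    using assms(1,2) by (metis min.absorb1 take_take)+
  then show False using assms(3) by simp
qed

lemma subtree_children: "disjoint_family_on subtree (range (\<lambda>k. s @ [k]))"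
  unfolding disjoint_family_on_def
proof (intro ballI impI)
  fix t u assume "t \<in> range (\<lambda>k. s @ [k])" "u \<in> range (\<lambda>k. s @ [k])" "t \<noteq> u"
  then show "subtree t \<inter> subtree u = {}"
    by (intro subtree_disjoint[of "Suc (length s)"]) auto
qed

text \<open>Of two first \<open>P\<close>-nodes neither is a proper initial segment of the other, so
  they already differ when cut to the shorter length.\<close>

lemma subtree_bar:
  "disjoint_family_on subtree {s. P s \<and> (\<forall>k<length s. \<not> P (take k s))}"
  unfolding disjoint_family_on_def
proof (intro ballI impI)
  fix s t assume st: "s \<in> {s. P s \<and> (\<forall>k<length s. \<not> P (take k s))}"
    "t \<in> {s. P s \<and> (\<forall>k<length s. \<not> P (take k s))}" "s \<noteq> t"
  let ?k = "min (length s) (length t)"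
  have "take ?k s \<noteq> take ?k t"
  proof
    assume eq: "take ?k s = take ?k t"
    show False
    proof (cases "length s" "length t" rule: linorder_cases)
      case less
      then have "take (length s) t = s" using eq by simp
      then show ?thesis using st(1,2) less by auto
    next
      case equal
      then show ?thesis using eq st(3) by simp
    next
      case greater
      then have "take (length t) s = t" using eq by simp
      then show ?thesis using st(1,2) greater by auto
    qed
  qed
  then show "subtree s \<inter> subtree t = {}" by (intro subtree_disjoint[of ?k]) auto
qed

end

section \<open>Non-minimality of the nodes and the missing predecessor\<close>

locale settled_tree = linked_tree U \<tau> A + split_set K e b
  for U \<tau> A and K :: "'a set" and e b +
  fixes x :: "nat list \<Rightarrow> nat set set"
  assumes free: "{n} \<notin> U" and x: "system x" "ultra (x s)" "settled \<pi> x"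
begin

lemma subtree_mem: "subtree s \<in> x s" and coh: "coherent U x"
  using x(1) by (auto simp: system_def)

lemma children_subtree: "{n. subtree (s @ [k]) \<in> x (s @ [n])} \<subseteq> {k}"
proof
  fix n assume "n \<in> {n. subtree (s @ [k]) \<in> x (s @ [n])}"
  then have "subtree (s @ [k]) \<inter> subtree (s @ [n]) \<in> x (s @ [n])"
    using fil_Int[OF coherent_fil[OF coh] _ subtree_mem] by blast
  then have "subtree (s @ [k]) \<inter> subtree (s @ [n]) \<noteq> {}" using fil_empty[OF coherent_fil[OF coh]] by metis
  then show "n \<in> {k}" using subtree_children[of s] by (auto simp: disjoint_family_on_def)
qed

text \<open>Only the child \<open>k\<close> can contain its subtree, so coherence would put
  \<open>{k}\<close> into the free ultrafilter \<open>U\<close>.\<close>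

lemma child_subtree_notin: "subtree (s @ [k]) \<notin> x s"
proof
  assume "subtree (s @ [k]) \<in> x s"
  from coherentD[OF coh this] have "{k} \<in> U" by (rule fil_mono[OF UF]) (rule children_subtree)
  then show False using free by blast
qed

lemma x_free: "{n} \<notin> x s"
proof
  assume n: "{n} \<in> x s"
  obtain k where k: "{n} \<in> x (s @ [k])" using ultra_ex[OF U coherentD[OF coh n]] by blast
  then have "{n} \<inter> subtree (s @ [k]) \<in> x (s @ [k])"
    using fil_Int[OF coherent_fil[OF coh] _ subtree_mem] by blast
  then have "n \<in> subtree (s @ [k])" using fil_empty[OF coherent_fil[OF coh]] by (metis disjoint_insert(2) inf_bot_right Int_commute)
  then have "subtree (s @ [k]) \<in> x s" using fil_mono[OF coherent_fil[OF coh] n] by blast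
  then show False using child_subtree_notin by blast
qed

text \<open>The children witness this: they live on disjoint subtrees, converge to
  \<open>x s\<close> along \<open>U\<close>, and differ from it by
  \<open>child_subtree_notin\<close>.\<close>

lemma non_minimal_node: "non_minimal K (push K e (x s))"
proof (rule non_minimal_push[where I = "range (\<lambda>k. s @ [k])" and z = x and B = subtree])
  show "push K e (x s) \<in> beta_remainder K" by (rule push_remainder[OF e x(2) x_free])
  show "\<exists>i\<in>range (\<lambda>k. s @ [k]). A \<in> push K e (x i)" if "A \<in> push K e (x s)" for A
    using that ultra_ex[OF U coherentD[OF coh, of "e -` A" s]] by (auto simp: push_def)
  show "push K e (x s) \<noteq> push K e (x i)" if "i \<in> range (\<lambda>k. s @ [k])" for i
  proof
    assume eq: "push K e (x s) = push K e (x i)"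
    have "e ` subtree i \<in> push K e (x i)"
      using e subtree_mem[of i] by (auto simp: push_def inj_vimage_image_eq)
    then have "e ` subtree i \<in> push K e (x s)" using eq by simp
    then have "subtree i \<in> x s" using e(1) by (simp add: push_def inj_vimage_image_eq)
    then show False using child_subtree_notin that by blast
  qed
qed (rule x(2) x_free subtree_children subtree_mem)+

lemma no_immediate_predecessor: "\<not> immediate_predecessor K F (push K e (x []))"
proof
  let ?G = "push K e (x [])"
  assume "immediate_predecessor K F ?G"
  then obtain X where F: "F \<in> beta K" and X: "discrete_enum K X" "\<And>a. a \<in> K \<Longrightarrow> minimal K (X a)"
    and G: "?G = Rudin_sum K X F"
    by (auto simp: immediate_predecessor_def)
  from X(1) obtain D where D: "disjoint_family_on D K" "(\<Union>a\<in>K. D a) = K" "\<And>a. a \<in> K \<Longrightarrow> D a \<in> X a"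
    by (auto simp: discrete_enum_def)
  have Xr: "X a \<in> beta_remainder K" if "a \<in> K" for a using X(2)[OF that] by (simp add: minimal_def)
  note Xf = beta_filter_on[OF remainder_beta[OF Xr]]
  note Ff = beta_filter_on[OF F]
  have some: "\<exists>a\<in>K. e ` B \<in> X a" if "B \<in> x []" for B
  proof -
    have "e ` B \<in> ?G" using that e by (auto simp: push_def inj_vimage_image_eq)
    then have "{a \<in> K. e ` B \<in> X a} \<in> F" by (simp add: G Rudin_sum_def)
    then show ?thesis using filter_on_empty[OF Ff] by (metis (mono_tags, lifting) Collect_empty_eq)
  qed
  have all: "e -` B \<in> x []" if "B \<subseteq> K" "\<And>a. a \<in> K \<Longrightarrow> B \<in> X a" for B
  proof -
    have "{a \<in> K. B \<in> X a} = K" using that by blast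
    then have "B \<in> ?G" using that filter_on_UNIV[OF Ff] unfolding G by (simp add: Rudin_sum_def)
    then show ?thesis by (simp add: push_def)
  qed
  have "\<forall>m. \<exists>a. a \<in> K \<and> e m \<in> D a" using D(2) e(2) by blast
  then obtain \<rho> where \<rho>: "\<And>m. \<rho> m \<in> K" "\<And>m. e m \<in> D (\<rho> m)" by metis
  have \<rho>_eq: "\<rho> m = a" if "a \<in> K" "e m \<in> D a" for m a
    using D(1) that \<rho>[of m] unfolding disjoint_family_on_def by blast
  \<comment> \<open>A piece of the partition that meets \<open>range e\<close> is named by the least
    \<open>k\<close> with \<open>e k\<close> in it. This gives a function on \<open>nat\<close> to
    which \<open>settled\<close> applies.\<close>
  define \<pi> where "\<pi> m = (LEAST k. \<rho> k = \<rho> m)" for m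
  have \<rho>\<pi>: "\<rho> (\<pi> m) = \<rho> m" for m unfolding \<pi>_def by (rule LeastI) simp
  have \<pi>_cong: "\<rho> m = \<rho> n \<Longrightarrow> \<pi> m = \<pi> n" for m n by (simp add: \<pi>_def)
  have "barred U (\<lambda>s. \<exists>m. {d. \<pi> d \<le> m} \<in> x s) []"
  proof (rule ccontr)
    assume "\<not> ?thesis"
    then obtain W :: "nat set \<Rightarrow> nat set" where W: "\<And>a. W a \<in> x []"
      and fin: "\<And>n \<Lambda>. finite \<Lambda> \<Longrightarrow> card \<Lambda> = Suc n \<Longrightarrow> finite {d. \<pi> d = n \<and> (\<forall>a\<in>\<Lambda>. d \<in> W a)}"
      using x(3)[of \<pi>] unfolding settled_def by blast
    have "\<exists>n. e ` W a \<in> X (\<rho> n) \<and> \<pi> n = n" for a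
    proof -
      obtain c where c: "c \<in> K" "e ` W a \<in> X c" using some[OF W] by blast
      then have "e ` W a \<inter> D c \<noteq> {}"
        using filter_on_Int[OF Xf[OF c(1)] c(2) D(3)] filter_on_empty[OF Xf[OF c(1)]] by auto
      \<comment> \<open>Thus \<open>c\<close> indexes a piece met by \<open>range e\<close>, and its
        name \<open>\<pi> m\<close> is a fixed point of \<open>\<pi>\<close>.\<close>
      then obtain m where "\<rho> m = c" using \<rho>_eq c(1) by blast
      then show ?thesis using c(2) \<rho>\<pi>[of m] \<pi>_cong[of "\<pi> m" m] by (intro exI[of _ "\<pi> m"]) simp
    qed
    then obtain \<nu> where \<nu>: "\<And>a. e ` W a \<in> X (\<rho> (\<nu> a))" "\<And>a. \<pi> (\<nu> a) = \<nu> a" by metis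
    \<comment> \<open>There are uncountably many sets \<open>a\<close> but only countably many
      values of \<open>\<nu>\<close>, so some fibre is infinite and supplies \<open>n + 1\<close>
      columns.\<close>
    have "\<exists>n. infinite {a. \<nu> a = n}"
    proof (rule ccontr)
      assume "\<nexists>n. infinite {a. \<nu> a = n}"
      then have "countable (\<Union>n. {a. \<nu> a = n})" by (intro countable_UN) (auto intro: countable_finite)
      moreover have "(\<Union>n. {a. \<nu> a = n}) = Pow (UNIV :: nat set)" by auto
      ultimately have "countable (Pow (UNIV :: nat set))" by metis
      then have "range (from_nat_into (Pow (UNIV :: nat set))) = Pow (UNIV :: nat set)"
        by (rule range_from_nat_into[OF Pow_not_empty])
      then show False using Cantors_theorem by metis
    qed
    then obtain n where "infinite {a. \<nu> a = n}" by blast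
    then obtain \<Lambda> where \<Lambda>: "finite \<Lambda>" "card \<Lambda> = Suc n" "\<Lambda> \<subseteq> {a. \<nu> a = n}"
      using infinite_arbitrarily_large by blast
    let ?a = "\<rho> n"
    obtain a0 where a0: "a0 \<in> \<Lambda>" using \<Lambda>(2) by fastforce
    then have n: "\<pi> n = n" using \<nu>(2)[of a0] \<Lambda>(3) by auto
    have "{d \<in> K. \<forall>a\<in>\<Lambda>. d \<in> e ` W a} \<in> X ?a"
      by (rule filter_on_finite_INT[OF Xf[OF \<rho>(1)] \<Lambda>(1)]) (use \<nu>(1) \<Lambda>(3) in auto)
    then have "{d \<in> K. \<forall>a\<in>\<Lambda>. d \<in> e ` W a} \<inter> D ?a \<in> X ?a"
      by (rule filter_on_Int[OF Xf[OF \<rho>(1)]]) (rule D(3)[OF \<rho>(1)])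
    moreover have "{d \<in> K. \<forall>a\<in>\<Lambda>. d \<in> e ` W a} \<inter> D ?a \<subseteq> e ` {d. \<pi> d = n \<and> (\<forall>a\<in>\<Lambda>. d \<in> W a)}"
    proof
      fix d assume d: "d \<in> {d \<in> K. \<forall>a\<in>\<Lambda>. d \<in> e ` W a} \<inter> D ?a"
      then obtain m where m: "d = e m" using a0 by blast
      have "\<rho> m = ?a" using d m by (intro \<rho>_eq \<rho>(1)) auto
      then have "\<pi> m = n" using \<pi>_cong[of m n] n by simp
      moreover have "m \<in> W a" if "a \<in> \<Lambda>" for a
        using d that m e(1) by (auto simp: inj_image_mem_iff)
      ultimately show "d \<in> e ` {d. \<pi> d = n \<and> (\<forall>a\<in>\<Lambda>. d \<in> W a)}" using m by blast
    qed
    ultimately show False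
      using remainder_finite[OF Xr[OF \<rho>(1)] finite_subset[OF _ finite_imageI[OF fin[OF \<Lambda>(1,2)]]]] by blast
  qed
  moreover have "\<exists>n. {d. \<pi> d = n} \<in> x s" if bd: "\<exists>m. {d. \<pi> d \<le> m} \<in> x s" for s
  proof -
    obtain m where "{d. \<pi> d \<le> m} \<in> x s" using bd by blast
    moreover have "{d. \<pi> d \<le> m} = (\<Union>n\<in>{..m}. {d. \<pi> d = n})" by auto
    ultimately have "(\<Union>n\<in>{..m}. {d. \<pi> d = n}) \<in> x s" by metis
    then show ?thesis using ultra_finite_UN[OF x(2) finite_atMost] by blast
  qed
  ultimately have "barred U (\<lambda>s. \<exists>n. {d. \<pi> d = n} \<in> x s) []" by (rule barred_mono)
  define const where "const s \<longleftrightarrow> (\<exists>n. {d. \<pi> d = n} \<in> x s)" for s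
  \<comment> \<open>Keeping only first nodes makes the ultrafilters on the bar discrete, by
    \<open>subtree_bar\<close>.\<close>
  define bar where "bar = {s. const s \<and> (\<forall>k<length s. \<not> const (take k s))}"
  have "barred U const []" unfolding const_def by fact
  then have barred: "barred U (\<lambda>s. s \<in> bar) []" using barred_first[of U const "[]"] by (simp add: bar_def)
  have "\<forall>s. \<exists>n. s \<in> bar \<longrightarrow> {d. \<pi> d = n} \<in> x s" by (auto simp: bar_def const_def)
  then obtain v where v: "\<And>s. s \<in> bar \<Longrightarrow> {d. \<pi> d = v s} \<in> x s" by metis
  \<comment> \<open>\<open>X a\<close> is minimal while the nodes are not, so it is not in the closure of the nodes
    on which \<open>\<rho> = a\<close>.\<close>
  have "\<exists>Q\<in>X a. \<forall>s\<in>bar. \<rho> (v s) = a \<longrightarrow> Q \<notin> push K e (x s)" if a: "a \<in> K" for a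
  proof (rule ccontr)
    assume neg: "\<not> ?thesis"
    have "non_minimal K (X a)"
    proof (rule non_minimal_push[where I = "{s \<in> bar. \<rho> (v s) = a}" and z = x and B = subtree])
      show "disjoint_family_on subtree {s \<in> bar. \<rho> (v s) = a}"
        using subtree_bar[of const] by (rule disjoint_family_on_mono[rotated]) (auto simp: bar_def)
      show "\<exists>i\<in>{s \<in> bar. \<rho> (v s) = a}. Q \<in> push K e (x i)" if "Q \<in> X a" for Q
        using neg that by blast
      show "X a \<noteq> push K e (x i)" for i
        using non_minimal_node[of i] X(2)[OF a] by (metis minimal_def)
    qed (rule x(2) x_free subtree_mem Xr[OF a])+
    then show False using X(2)[OF a] by (simp add: minimal_def)
  qed
  then obtain Q where Q: "\<And>a. a \<in> K \<Longrightarrow> Q a \<in> X a"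
      "\<And>a s. a \<in> K \<Longrightarrow> s \<in> bar \<Longrightarrow> \<rho> (v s) = a \<Longrightarrow> Q a \<notin> push K e (x s)"
    by metis
  \<comment> \<open>Gluing the \<open>Q a\<close> along the pieces gives a set in every
    \<open>X a\<close>, hence in the sum, hence in \<open>x s\<close> for some \<open>s\<close> on
    the bar. Where \<open>\<pi>\<close> equals \<open>v s\<close>, it lies inside
    \<open>Q (\<rho> (v s))\<close>, against the choice of \<open>Q\<close>.\<close>
  define R where "R = (\<Union>a\<in>K. Q a \<inter> D a)"
  have "R \<subseteq> K" using D(2) by (auto simp: R_def)
  moreover have "R \<in> X a" if "a \<in> K" for a
    by (rule filter_on_mono[OF Xf[OF that] filter_on_Int[OF Xf[OF that] Q(1)[OF that] D(3)[OF that]]])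
      (use that \<open>R \<subseteq> K\<close> in \<open>auto simp: R_def\<close>)
  ultimately have "e -` R \<in> x []" by (rule all)
  then obtain s where s: "s \<in> bar" "e -` R \<in> x s" using barred_hit[OF UF coh barred] by blast
  have "e -` R \<inter> {d. \<pi> d = v s} \<in> x s" by (rule fil_Int[OF coherent_fil[OF coh] s(2) v[OF s(1)]])
  moreover have "e -` R \<inter> {d. \<pi> d = v s} \<subseteq> e -` Q (\<rho> (v s))"
  proof
    fix d assume d: "d \<in> e -` R \<inter> {d. \<pi> d = v s}"
    then obtain a where a: "a \<in> K" "e d \<in> Q a" "e d \<in> D a" by (auto simp: R_def)
    have "a = \<rho> (v s)" using \<rho>_eq[OF a(1,3)] \<rho>\<pi>[of d] d by simp
    then show "d \<in> e -` Q (\<rho> (v s))" using a(2) by simp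
  qed
  ultimately have "e -` Q (\<rho> (v s)) \<in> x s" by (rule fil_mono[OF coherent_fil[OF coh]])
  moreover have "Q (\<rho> (v s)) \<subseteq> K" by (rule filter_on_sub[OF Xf Q(1)]) (rule \<rho>(1))+
  ultimately show False using Q(2)[OF \<rho>(1) s(1) refl] by (simp add: push_def)
qed

end

theorem theorem1:
  fixes r :: "'a rel" and \<phi> :: "'a set set \<Rightarrow> 'a set"
  assumes "Card_order r" and "infinite (Field r)" and "regularCard r"
    and "shrinking r \<phi>"
  shows "\<exists>G \<in> beta_remainder (Field r). Simon_point (Field r) G"
proof -
  obtain U :: "nat set set" where ultra_U: "ultra U" and free_U: "\<And>n. {n} \<notin> U" using free_ultrafilter_exists by blast
  obtain \<tau> A where "linked_tree U \<tau> A"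
    using linked_family_exists ultra_U unfolding linked_tree_def by metis
  then interpret linked_tree U \<tau> A .
  obtain x where "system x" "\<And>s. ultra (x s)" "\<And>\<pi>. settled \<pi> x"
    by (rule settled_ultra_system_exists) blast
  obtain e b where "split_set (Field r) e b" using split_set_exists[OF assms(2)] by blast
  then interpret split_set "Field r" e b .
  interpret settled_tree U \<tau> A "Field r" e b x
    by unfold_locales fact+
  let ?G = "push (Field r) e (x [])"
  have "non_minimal (Field r) ?G" by (rule non_minimal_node)
  then have "Simon_point (Field r) ?G" "?G \<in> beta_remainder (Field r)"
    using no_immediate_predecessor by (auto simp: Simon_point_def non_minimal_def)
  then show ?thesis by blast
qed

end
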